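(* Let $\mathbb{G}$ be a stratified group whose first stratum has dimension $N\geq 3$, and let $\mathcal{L}=\sum_{k=1}^{N}X_k^2$ be its sub-Laplacian. Let $\delta\in\mathbb{R}$ with $-N/2\leq\delta\leq -1$. Then for all complex-valued functions $f\in C_0^\infty(\mathbb{G}\backslash\{x'=0\})$ we have $$\left\|\frac{\mathcal{L} f}{|x'|^{\delta}}\right\|_{L^{2}(\mathbb{G})}\geq\left|\frac{(N-2\delta-4)(N+2\delta)}{4}\right|\left\|\frac{f}{|x'|^{\delta+2}}\right\|_{L^{2}(\mathbb{G})}.$$ Moreover, if $N+2\delta\neq 0$, then the constant $\left|\frac{(N-2\delta-4)(N+2\delta)}{4}\right|$ is sharp, i.e. the inequality (for all such $f$) fails if it is replaced by any larger constant.
   Context: A stratified group (homogeneous Carnot group) is a Lie group $\mathbb{G}=(\mathbb{R}^n,\circ)$ such that: (i) there are natural numbers $N=N_1,N_2,\ldots,N_r$ with $N_1+\cdots+N_r=n$, and, writing $x=(x',x^{(2)},\ldots,x^{(r)})\in\mathbb{R}^{N}\times\mathbb{R}^{N_2}\times\cdots\times\mathbb{R}^{N_r}$, for every $\lambda>0$ the dilation $\delta_\lambda(x)=(\lambda x',\lambda^2x^{(2)},\ldots,\lambda^r x^{(r)})$ is an automorphism of $\mathbb{G}$; (ii) the left-invariant vector fields $X_1,\ldots,X_N$ on $\mathbb{G}$ with $X_k(0)=\frac{\partial}{\partial x_k}\big|_0$, $k=1,\ldots,N$, satisfy $\mathrm{rank}(\mathrm{Lie}\{X_1,\ldots,X_N\})=n$,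 i.e. their iterated commutators span the Lie algebra of $\mathbb{G}$. The number $N$ is the dimension of the first stratum. The Lebesgue measure $dx$ on $\mathbb{R}^n$ is the Haar measure of $\mathbb{G}$, and $L^2(\mathbb{G})$ is taken with respect to it. $|x'|$ denotes the Euclidean norm of $x'\in\mathbb{R}^N$. $C_0^\infty$ denotes smooth compactly supported functions, and $\mathbb{G}\backslash\{x'=0\}$ is the open set of points with $x'\neq 0$. *)

theory Defs
  imports "HOL-Analysis.Analysis"
begin

(* Meant for open S and a finite-dimensional domain, where it is the usual notion of C^k:
   continuity of the derivative is required direction by direction. *)

primrec Ck_on :: "nat \<Rightarrow> 'a::real_normed_vector set \<Rightarrow> ('a \<Rightarrow> 'b::real_normed_vector) \<Rightarrow> bool" where
  "Ck_on 0 S f \<longleftrightarrow> continuous_on S f"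
| "Ck_on (Suc k) S f \<longleftrightarrow>
     (\<forall>x\<in>S. f differentiable (at x)) \<and> (\<forall>v. Ck_on k S (\<lambda>x. frechet_derivative f (at x) v))"

definition smooth_on :: "'a::real_normed_vector set \<Rightarrow> ('a \<Rightarrow> 'b::real_normed_vector) \<Rightarrow> bool" where
  "smooth_on S f \<longleftrightarrow> (\<forall>k. Ck_on k S f)"

(* Functions in C_0^infinity(U), U open, are represented by their extension by zero. *)

definition test_functions :: "'a::real_normed_vector set \<Rightarrow> ('a \<Rightarrow> complex) set" where
  "test_functions U =
     {f. smooth_on UNIV f \<and> compact (closure {x. f x \<noteq> 0}) \<and> closure {x. f x \<noteq> 0} \<subseteq> U}"

(* Bochner integral: meaningful only for square-integrable f. It is applied below to
   continuous compactly supported functions. *)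

definition L2_norm :: "('a::euclidean_space \<Rightarrow> complex) \<Rightarrow> real" where
  "L2_norm f = sqrt (\<integral>x. (norm (f x))\<^sup>2 \<partial>lborel)"

(* A vector field V is identified with its coefficient map; it acts on functions as a
   derivation, and vf_bracket V W is the coefficient map of VW - WV. *)

definition vf_apply ::
  "('a::real_normed_vector \<Rightarrow> 'a) \<Rightarrow> ('a \<Rightarrow> 'b::real_normed_vector) \<Rightarrow> 'a \<Rightarrow> 'b" where
  "vf_apply V f x = frechet_derivative f (at x) (V x)"

definition vf_bracket ::
  "('a::real_normed_vector \<Rightarrow> 'a) \<Rightarrow> ('a \<Rightarrow> 'a) \<Rightarrow> 'a \<Rightarrow> 'a" where
  "vf_bracket V W x = vf_apply V W x - vf_apply W V x"

inductive_set lie_generated :: "('a::real_normed_vector \<Rightarrow> 'a) set \<Rightarrow> ('a \<Rightarrow> 'a) set"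
  for S where
  base: "V \<in> S \<Longrightarrow> V \<in> lie_generated S"
| zero: "(\<lambda>x. 0) \<in> lie_generated S"
| add: "V \<in> lie_generated S \<Longrightarrow> W \<in> lie_generated S \<Longrightarrow> (\<lambda>x. V x + W x) \<in> lie_generated S"
| scale: "V \<in> lie_generated S \<Longrightarrow> (\<lambda>x. c *\<^sub>R V x) \<in> lie_generated S"
| bracket: "V \<in> lie_generated S \<Longrightarrow> W \<in> lie_generated S \<Longrightarrow> vf_bracket V W \<in> lie_generated S"

definition lie_group_op :: "('a::real_normed_vector \<Rightarrow> 'a \<Rightarrow> 'a) \<Rightarrow> bool" where
  "lie_group_op mul \<longleftrightarrow>
     (\<exists>e i. group mul e i \<and> smooth_on UNIV (\<lambda>(x, y). mul x y) \<and> smooth_on UNIV i)"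

definition left_invariant ::
  "('a::real_normed_vector \<Rightarrow> 'a \<Rightarrow> 'a) \<Rightarrow> ('a \<Rightarrow> 'a) \<Rightarrow> bool" where
  "left_invariant mul V \<longleftrightarrow>
     smooth_on UNIV V \<and> (\<forall>x y. frechet_derivative (mul x) (at y) (V y) = V (mul x y))"

(* The splitting R^n = R^{N_1} x ... x R^{N_r} is given by the map w sending each coordinate
   index to the number of its block, so N_j = card {i. w i = j}. *)

definition dilation :: "('n::finite \<Rightarrow> nat) \<Rightarrow> real \<Rightarrow> real^'n \<Rightarrow> real^'n" where
  "dilation w c x = (\<chi> i. c ^ w i * x $ i)"

abbreviation first_stratum :: "('n::finite \<Rightarrow> nat) \<Rightarrow> 'n set" where
  "first_stratum w \<equiv> {k. w k = 1}"

(* Dilations with c > 0 are linear bijections, so only the homomorphism property is required.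
   It forces the neutral element to be 0. The fields X k matter only for k in the first
   stratum, where the conditions below determine them uniquely. *)

locale stratified_group =
  fixes mul :: "real^'n::finite \<Rightarrow> real^'n \<Rightarrow> real^'n"
    and w :: "'n \<Rightarrow> nat"
    and X :: "'n \<Rightarrow> real^'n \<Rightarrow> real^'n"
  assumes lie_group: "lie_group_op mul"
    and strata: "\<exists>r. range w = {1..r}"
    and dilation_hom:
      "c > 0 \<Longrightarrow> dilation w c (mul x y) = mul (dilation w c x) (dilation w c y)"
    and left_invariant_X: "k \<in> first_stratum w \<Longrightarrow> left_invariant mul (X k)"
    and X_at_0: "k \<in> first_stratum w \<Longrightarrow> X k 0 = axis k 1"
    and rank: "dim {V x |V. V \<in> lie_generated (X ` first_stratum w)} = CARD('n)"

definition sub_laplacian ::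
  "('n::finite \<Rightarrow> nat) \<Rightarrow> ('n \<Rightarrow> real^'n \<Rightarrow> real^'n) \<Rightarrow> (real^'n \<Rightarrow> complex) \<Rightarrow> real^'n \<Rightarrow> complex" where
  "sub_laplacian w X f x = (\<Sum>k\<in>first_stratum w. vf_apply (X k) (vf_apply (X k) f) x)"

(* The Euclidean norm |x'| of the first-stratum component. *)

definition horizontal_norm :: "('n::finite \<Rightarrow> nat) \<Rightarrow> real^'n \<Rightarrow> real" where
  "horizontal_norm w x = L2_set (\<lambda>i. x $ i) (first_stratum w)"

end

theory Submission
  imports Defs
begin

text \<open>
  Everything follows from two consequences of the dilation structure. The field \<open>X\<^sub>k\<close> is
  homogeneous: its \<open>i\<close>-th coefficient has degree \<open>w i - 1\<close>. Since a continuous function of negative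
  degree vanishes and one of degree zero is constant, \<open>X\<^sub>k\<close> is divergence free
  (\<open>X_divergence_free\<close>), so \<open>X\<^sub>k g\<close> has integral zero for every test function \<open>g\<close>, and \<open>X\<^sub>k\<close> acts
  on functions of \<open>x'\<close> as the partial derivative in direction \<open>k\<close> (\<open>X_first_stratum\<close>). Hence
  powers of \<open>|x'|\<close> are differentiated as in Euclidean space of dimension \<open>N\<close>. Write
  \<open>C = (N - 2\<delta> - 4) (N + 2\<delta>) / 4\<close>, which is nonnegative in the given range of \<open>\<delta>\<close>.

  For the inequality, integrate \<open>-(L f \<bullet> f) |x'| powr (-2\<delta> - 2)\<close> by parts, using
  the real inner product on the complex numbers. Completing the square as in Hardy's
  inequality bounds this integral below by \<open>C\<close> times the integral of
  \<open>|f|\<^sup>2 |x'| powr (-2\<delta> - 4)\<close>. A second square, that of \<open>L f + C f / |x'|\<^sup>2\<close>, turns the bound for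
  the mixed term into one for \<open>|L f|\<^sup>2\<close>. Both squares are completed pointwise in
  \<open>rellich_pointwise\<close>, up to a sum of terms \<open>X\<^sub>k g\<^sub>k\<close> that integrate to zero; this gives
  \<open>rellich_integral_inequality\<close>.

  For sharpness, the extremal profile is \<open>|x'| powr (-(N - 2\<delta> - 4) / 2)\<close>, which must be cut off in two
  ways. In the directions of the higher strata take a cutoff \<open>\<psi>\<close> composed with the dilation by a
  small \<open>\<epsilon>\<close>: each \<open>X\<^sub>k\<close> falling on it produces a factor \<open>\<epsilon>\<close>, so in the limit \<open>\<epsilon> \<longrightarrow> 0\<close> only the Euclidean Laplacian in \<open>x'\<close>
  survives (\<open>rellich_two_scale_limit\<close>). In \<open>x'\<close> multiply the profile by \<open>h (ln |x'|\<^sup>2)\<close>, where \<open>h\<close>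
  is a plateau of length \<open>M\<close>. In the variable \<open>ln |x'|\<^sup>2\<close> the weighted measure is translation
  invariant (\<open>integral_log_mass\<close>), so the plateau contributes proportionally to \<open>M\<close>, with ratio
  exactly \<open>C\<^sup>2\<close>, while its two flanks contribute a bounded amount. Letting \<open>M\<close> grow rules out every
  constant above \<open>C\<close> (\<open>rellich_constant_le\<close>).
\<close>

section \<open>Calculus of \<open>C\<^sup>k\<close> functions\<close>

lemma Ck_on_cong_imp:
  assumes "open S" "\<And>x. x \<in> S \<Longrightarrow> f x = g x" "Ck_on k S f"
  shows "Ck_on k S g"
  using assms(2,3)
proof (induction k arbitrary: f g)
  case 0
  then show ?case by (simp cong: continuous_on_cong)
next
  case (Suc k)
  have diff: "f differentiable (at x)" if "x \<in> S" for x
    using Suc.prems(2) that by simp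
  have eq: "frechet_derivative f (at x) = frechet_derivative g (at x)" if "x \<in> S" for x
    using frechet_derivative_transform_within_open[OF diff[OF that] assms(1) that Suc.prems(1)] .
  have "g differentiable (at x)" if "x \<in> S" for x
    using diff[OF that] assms(1) that Suc.prems(1)
    unfolding differentiable_def by (blast intro: has_derivative_transform_within_open)
  moreover have "Ck_on k S (\<lambda>x. frechet_derivative g (at x) v)" for v
  proof (rule Suc.IH)
    show "frechet_derivative f (at x) v = frechet_derivative g (at x) v" if "x \<in> S" for x
      using eq[OF that] by simp
    show "Ck_on k S (\<lambda>x. frechet_derivative f (at x) v)"
      using Suc.prems(2) by simp
  qed
  ultimately show ?case by simp
qed

lemma Ck_on_SucI:
  assumes "open S" "\<And>x. x \<in> S \<Longrightarrow> (f has_derivative D x) (at x)"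
    and "\<And>v. Ck_on k S (\<lambda>x. D x v)"
  shows "Ck_on (Suc k) S f"
proof -
  have "D x = frechet_derivative f (at x)" if "x \<in> S" for x
    using frechet_derivative_at assms(2) that by blast
  then have "Ck_on k S (\<lambda>x. frechet_derivative f (at x) v)" for v
    using Ck_on_cong_imp[OF assms(1) _ assms(3)[of v]] by simp
  then show ?thesis
    using assms(2) by (auto simp: differentiable_def)
qed

lemma Ck_on_Suc_has_derivative:
  assumes "Ck_on (Suc k) S f" "x \<in> S"
  shows "(f has_derivative frechet_derivative f (at x)) (at x)"
  using assms frechet_derivative_works by auto

lemma Ck_on_Suc_imp_continuous_on: "Ck_on (Suc k) S f \<Longrightarrow> continuous_on S f"
  by (intro continuous_at_imp_continuous_on ballI)
     (rule has_derivative_continuous, rule Ck_on_Suc_has_derivative)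

lemma Ck_on_SucD: "Ck_on (Suc k) S f \<Longrightarrow> Ck_on k S f"
proof (induction k arbitrary: f)
  case 0
  then show ?case using Ck_on_Suc_imp_continuous_on[of 0 S f] by simp
next
  case (Suc k)
  have "Ck_on (Suc k) S (\<lambda>x. frechet_derivative f (at x) v)" for v
    using Suc.prems Ck_on.simps(2)[of "Suc k" S f] by blast
  then have "Ck_on k S (\<lambda>x. frechet_derivative f (at x) v)" for v
    using Suc.IH by blast
  then show ?case using Suc.prems by simp
qed

lemma Ck_on_imp_continuous_on: "Ck_on k S f \<Longrightarrow> continuous_on S f"
  by (cases k) (use Ck_on_Suc_imp_continuous_on in auto)

lemma Ck_on_subset: "Ck_on k S f \<Longrightarrow> T \<subseteq> S \<Longrightarrow> Ck_on k T f"
  by (induction k arbitrary: f) (auto intro: continuous_on_subset)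

text \<open>Powers of \<open>|x'|\<close> are smooth only where \<open>x' \<noteq> 0\<close>. A product that vanishes near \<open>x' = 0\<close> becomes
  globally smooth by gluing it there with the zero function.\<close>

lemma Ck_on_open_Un:
  "open S \<Longrightarrow> open T \<Longrightarrow> Ck_on k S f \<Longrightarrow> Ck_on k T f \<Longrightarrow> Ck_on k (S \<union> T) f"
  by (induction k arbitrary: f) (auto intro: continuous_on_open_Un)

lemma Ck_on_const: "Ck_on k S (\<lambda>x. c)"
  by (induction k arbitrary: c) auto

lemma Ck_on_bounded_linear:
  assumes "bounded_linear f"
  shows "Ck_on k S f"
proof (cases k)
  case 0
  then show ?thesis using assms by (simp add: linear_continuous_on)
next
  case (Suc j)
  have d: "(f has_derivative f) (at x)" for x
    using assms bounded_linear_imp_has_derivative by blast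
  have "frechet_derivative f (at x) = f" for x
    using frechet_derivative_at[OF d] by simp
  then show ?thesis using d Suc by (auto simp: differentiable_def Ck_on_const)
qed

lemma Ck_on_linear_comp:
  assumes "open S" "bounded_linear L" "Ck_on k S f"
  shows "Ck_on k S (\<lambda>x. L (f x))"
  using assms(3)
proof (induction k arbitrary: f)
  case 0
  then show ?case using assms(2) by (auto intro: bounded_linear.continuous_on)
next
  case (Suc k)
  show ?case
  proof (rule Ck_on_SucI[OF assms(1)])
    show "((\<lambda>x. L (f x)) has_derivative (\<lambda>v. L (frechet_derivative f (at x) v))) (at x)"
      if "x \<in> S" for x
      using bounded_linear.has_derivative[OF assms(2) Ck_on_Suc_has_derivative[OF Suc.prems that]] .
    show "Ck_on k S (\<lambda>x. L (frechet_derivative f (at x) v))" for v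
      using Suc.IH Suc.prems by simp
  qed
qed

lemma Ck_on_add:
  assumes "open S" "Ck_on k S f" "Ck_on k S g"
  shows "Ck_on k S (\<lambda>x. f x + g x)"
  using assms(2,3)
proof (induction k arbitrary: f g)
  case 0
  then show ?case by (auto intro: continuous_on_add)
next
  case (Suc k)
  show ?case
  proof (rule Ck_on_SucI[OF assms(1)])
    show "((\<lambda>x. f x + g x) has_derivative
        (\<lambda>v. frechet_derivative f (at x) v + frechet_derivative g (at x) v)) (at x)"
      if "x \<in> S" for x
      using Ck_on_Suc_has_derivative[OF _ that] Suc.prems by (intro has_derivative_add) auto
    show "Ck_on k S (\<lambda>x. frechet_derivative f (at x) v + frechet_derivative g (at x) v)" for v
      using Suc.IH Suc.prems by simp
  qed
qed

lemma Ck_on_sum: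
  assumes "open S" "\<And>i. i \<in> I \<Longrightarrow> Ck_on k S (f i)"
  shows "Ck_on k S (\<lambda>x. \<Sum>i\<in>I. f i x)"
proof (cases "finite I")
  case True
  then show ?thesis using assms(2)
    by (induction rule: finite_induct) (auto simp: Ck_on_const intro: Ck_on_add[OF assms(1)])
qed (simp add: Ck_on_const)

lemma Ck_on_bilinear:
  assumes "open S" "bounded_bilinear B" "Ck_on k S f" "Ck_on k S g"
  shows "Ck_on k S (\<lambda>x. B (f x) (g x))"
  using assms(3,4)
proof (induction k arbitrary: f g)
  case 0
  then show ?case using assms(2) by (auto intro: bounded_bilinear.continuous_on)
next
  case (Suc k)
  show ?case
  proof (rule Ck_on_SucI[OF assms(1)])
    show "((\<lambda>x. B (f x) (g x)) has_derivative
        (\<lambda>v. B (f x) (frechet_derivative g (at x) v) + B (frechet_derivative f (at x) v) (g x))) (at x)"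
      if "x \<in> S" for x
      using bounded_bilinear.FDERIV[OF assms(2) Ck_on_Suc_has_derivative[OF Suc.prems(1) that]
          Ck_on_Suc_has_derivative[OF Suc.prems(2) that]] .
    show "Ck_on k S (\<lambda>x. B (f x) (frechet_derivative g (at x) v)
        + B (frechet_derivative f (at x) v) (g x))" for v
      using Suc.IH Suc.prems Ck_on_SucD[OF Suc.prems(1)] Ck_on_SucD[OF Suc.prems(2)]
      by (intro Ck_on_add[OF assms(1)]) auto
  qed
qed

lemmas Ck_on_mult = Ck_on_bilinear[OF _ bounded_bilinear_mult]
lemmas Ck_on_scaleR = Ck_on_bilinear[OF _ bounded_bilinear_scaleR]
lemmas Ck_on_inner = Ck_on_bilinear[OF _ bounded_bilinear_inner]

lemma Ck_on_diff:
  "open S \<Longrightarrow> Ck_on k S f \<Longrightarrow> Ck_on k S g \<Longrightarrow> Ck_on k S (\<lambda>x. f x - g x)"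
  using Ck_on_add[of S k f "\<lambda>x. - g x"] Ck_on_linear_comp[of S uminus k g]
  by (simp add: bounded_linear_minus bounded_linear_ident)

lemma Ck_on_comp_linear:
  fixes L :: "'a::real_normed_vector \<Rightarrow> 'b::real_normed_vector"
  assumes "bounded_linear L" "Ck_on k UNIV f"
  shows "Ck_on k UNIV (\<lambda>x. f (L x))"
  using assms(2)
proof (induction k arbitrary: f)
  case 0
  then have "continuous_on UNIV f" by simp
  then show ?case
    using continuous_on_compose2[OF _ linear_continuous_on[OF assms(1)], of UNIV f] by simp
next
  case (Suc k)
  show ?case
  proof (rule Ck_on_SucI[OF open_UNIV])
    show "((\<lambda>x. f (L x)) has_derivative (\<lambda>v. frechet_derivative f (at (L x)) (L v))) (at x)" for x
      using has_derivative_compose[OF bounded_linear_imp_has_derivative[OF assms(1)]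
          Ck_on_Suc_has_derivative[OF Suc.prems]] by simp
    show "Ck_on k UNIV (\<lambda>x. frechet_derivative f (at (L x)) (L v))" for v
      using Suc.IH[of "\<lambda>y. frechet_derivative f (at y) (L v)"] Suc.prems by simp
  qed
qed

lemma frechet_derivative_real:
  fixes g :: "real \<Rightarrow> 'b::real_normed_vector"
  assumes "g differentiable (at y)"
  shows "frechet_derivative g (at y) v = v *\<^sub>R frechet_derivative g (at y) 1"
  using linear_frechet_derivative[OF assms] linear_cmul[of "frechet_derivative g (at y)" v 1] by simp

lemma Ck_on_compose_real:
  fixes g :: "real \<Rightarrow> real"
  assumes "open S" "Ck_on k T g" "Ck_on k S u" "u ` S \<subseteq> T"
  shows "Ck_on k S (\<lambda>x. g (u x))"
  using assms(2,3)
proof (induction k arbitrary: g)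
  case 0
  then show ?case using assms(4) by (auto intro: continuous_on_compose2)
next
  case (Suc k)
  show ?case
  proof (rule Ck_on_SucI[OF assms(1)])
    show "((\<lambda>x. g (u x)) has_derivative
      (\<lambda>v. frechet_derivative u (at x) v * frechet_derivative g (at (u x)) 1)) (at x)"
      if "x \<in> S" for x
    proof -
      have ux: "u x \<in> T" using that assms(4) by auto
      have "g differentiable (at (u x))" using Suc.prems(1) ux by simp
      from frechet_derivative_real[OF this]
      have "(\<lambda>v. frechet_derivative g (at (u x)) (frechet_derivative u (at x) v))
          = (\<lambda>v. frechet_derivative u (at x) v * frechet_derivative g (at (u x)) 1)"
        by (metis real_scaleR_def)
      then show ?thesis
        using has_derivative_compose[OF Ck_on_Suc_has_derivative[OF Suc.prems(2) that]
            Ck_on_Suc_has_derivative[OF Suc.prems(1) ux]] by metis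
    qed
    show "Ck_on k S (\<lambda>x. frechet_derivative u (at x) v * frechet_derivative g (at (u x)) 1)" for v
      using Suc.IH[of "\<lambda>y. frechet_derivative g (at y) 1"] Suc.prems Ck_on_SucD[OF Suc.prems(2)]
      by (intro Ck_on_mult[OF assms(1)]) auto
  qed
qed

text \<open>Real powers and \<open>exp (-1/t)\<close> are smooth because their derivatives never leave an explicit class
  of functions: multiples of powers, and polynomials in \<open>1/t\<close> times \<open>exp (-1/t)\<close>, respectively.\<close>

lemma Ck_on_derivative_closed:
  fixes F :: "(real \<Rightarrow> real) set"
  assumes "open T" "\<And>g. g \<in> F \<Longrightarrow> \<exists>g'\<in>F. \<forall>y\<in>T. (g has_real_derivative g' y) (at y)" "g \<in> F"
  shows "Ck_on k T g"
  using assms(3)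
proof (induction k arbitrary: g)
  case 0
  then obtain g' where "\<forall>y\<in>T. (g has_real_derivative g' y) (at y)" using assms(2) by blast
  then show ?case by (auto intro!: continuous_at_imp_continuous_on DERIV_isCont)
next
  case (Suc k)
  then obtain g' where g': "g' \<in> F" "\<forall>y\<in>T. (g has_real_derivative g' y) (at y)"
    using assms(2) by blast
  show ?case
    by (rule Ck_on_SucI[OF assms(1), of _ "\<lambda>y v. g' y * v"])
       (use g' Suc.IH in \<open>auto simp: has_field_derivative_def intro: Ck_on_mult[OF assms(1)] Ck_on_const\<close>)
qed

lemma Ck_on_powr: "Ck_on k {0<..} (\<lambda>y::real. y powr s)"
proof -
  have *: "\<exists>g'\<in>{\<lambda>y. c * y powr s |c s. True}. \<forall>y\<in>{0<..}. (g has_real_derivative g' y) (at y)"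
    if "g \<in> {\<lambda>y::real. c * y powr s |c s. True}" for g
  proof -
    from that obtain c s where g: "g = (\<lambda>y. c * y powr s)" by blast
    have "\<forall>y\<in>{0<..}. (g has_real_derivative (c * s) * y powr (s - 1)) (at y)"
      unfolding g by (auto intro!: derivative_eq_intros)
    then show ?thesis by (intro bexI[of _ "\<lambda>y. (c * s) * y powr (s - 1)"]) blast+
  qed
  have "(\<lambda>y::real. y powr s) \<in> {\<lambda>y. c * y powr s |c s. True}"
    by (rule CollectI, rule exI[of _ 1], rule exI[of _ s]) simp
  from Ck_on_derivative_closed[OF _ * this] show ?thesis by simp
qed

lemma Ck_on_ln: "Ck_on k {0<..} (ln :: real \<Rightarrow> real)"
proof (cases k)
  case 0
  then show ?thesis by (auto intro!: continuous_intros)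
next
  case (Suc j)
  have "Ck_on j {0<..} (\<lambda>y. v * (y::real) powr (- 1))" for v
    by (intro Ck_on_mult Ck_on_const Ck_on_powr) auto
  moreover have "(ln has_derivative (\<lambda>v. v * y powr (- 1))) (at y)" if "y \<in> {0<..}" for y :: real
    using that by (auto simp: powr_minus field_simps intro!: derivative_eq_intros)
  ultimately show ?thesis
    unfolding Suc by (intro Ck_on_SucI[where D = "\<lambda>y v. v * y powr (- 1)"]) auto
qed

lemma Ck_on_shift: "Ck_on k UNIV g \<Longrightarrow> Ck_on k UNIV (\<lambda>t::real. g (t - s) :: real)"
  by (rule Ck_on_compose_real[OF open_UNIV, of _ UNIV])
     (auto intro!: Ck_on_diff Ck_on_const Ck_on_bounded_linear[OF bounded_linear_ident])

lemma Ck_on_real_derivative: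
  fixes g :: "real \<Rightarrow> real"
  assumes "\<And>m. Ck_on m UNIV g"
  obtains g' where "\<And>t. (g has_real_derivative g' t) (at t)" "\<And>m. Ck_on m UNIV g'"
proof
  define g' where "g' t = frechet_derivative g (at t) 1" for t
  show "Ck_on m UNIV g'" for m
    using assms[of "Suc m"] by (simp add: g'_def[abs_def])
  show "(g has_real_derivative g' t) (at t)" for t
  proof -
    have d: "g differentiable (at t)" using assms[of 1] by simp
    have "frechet_derivative g (at t) = (*) (g' t)"
      unfolding g'_def by (rule ext, subst frechet_derivative_real[OF d]) simp
    then show ?thesis
      using d by (simp add: has_field_derivative_def frechet_derivative_works)
  qed
qed

lemma derivative_locally_constant:
  assumes "(g has_real_derivative d) (at t)" "open U" "t \<in> U" "\<And>s. s \<in> U \<Longrightarrow> g s = c"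
  shows "d = 0"
proof -
  have "((\<lambda>_. c) has_real_derivative d) (at t)"
    by (rule has_field_derivative_transform_within_open[OF assms(1-3)]) (use assms(4) in auto)
  then show ?thesis using DERIV_unique DERIV_const by blast
qed

section \<open>Vector fields as derivations\<close>

lemma vf_apply_eq: "(f has_derivative D) (at x) \<Longrightarrow> vf_apply V f x = D (V x)"
  unfolding vf_apply_def using frechet_derivative_at by metis

lemma vf_apply_cong:
  assumes "open U" "x \<in> U" "\<And>y. y \<in> U \<Longrightarrow> f y = g y" "f differentiable (at x)"
  shows "vf_apply V f x = vf_apply V g x"
  unfolding vf_apply_def using frechet_derivative_transform_within_open[OF assms(4,1,2,3)] by simp

lemma vf_apply_locally_zero:
  assumes "open U" "x \<in> U" "\<And>y. y \<in> U \<Longrightarrow> f y = 0"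
  shows "vf_apply V f x = 0"
  using vf_apply_cong[OF assms(1,2), of "\<lambda>y. 0" f V] assms(3) by (simp add: vf_apply_def)

lemma vf_apply_bilinear:
  assumes "bounded_bilinear B" "f differentiable (at x)" "g differentiable (at x)"
  shows "vf_apply V (\<lambda>x. B (f x) (g x)) x = B (f x) (vf_apply V g x) + B (vf_apply V f x) (g x)"
  using vf_apply_eq[OF bounded_bilinear.FDERIV[OF assms(1) assms(2,3)[unfolded frechet_derivative_works]]]
  by (simp add: vf_apply_def)

lemmas vf_apply_mult = vf_apply_bilinear[OF bounded_bilinear_mult]
lemmas vf_apply_inner = vf_apply_bilinear[OF bounded_bilinear_inner]

lemma vf_apply_add:
  assumes "f differentiable (at x)" "g differentiable (at x)"
  shows "vf_apply V (\<lambda>x. f x + g x) x = vf_apply V f x + vf_apply V g x"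
  using vf_apply_eq[OF has_derivative_add[OF assms[unfolded frechet_derivative_works]]]
  by (simp add: vf_apply_def)

lemma vf_apply_linear:
  assumes "bounded_linear L" "f differentiable (at x)"
  shows "vf_apply V (\<lambda>x. L (f x)) x = L (vf_apply V f x)"
  using vf_apply_eq[OF bounded_linear.has_derivative[OF assms(1) assms(2)[unfolded frechet_derivative_works]]]
  by (simp add: vf_apply_def)

lemma vf_apply_compose_real:
  fixes g :: "real \<Rightarrow> real"
  assumes "(g has_real_derivative d) (at (u x))" "u differentiable (at x)"
  shows "vf_apply V (\<lambda>x. g (u x)) x = d * vf_apply V u x"
  using vf_apply_eq[OF has_derivative_compose[OF assms(2)[unfolded frechet_derivative_works]
        assms(1)[unfolded has_field_derivative_def]]]
  by (simp add: vf_apply_def)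

lemma vf_apply_coordinates:
  fixes V :: "real^'n::finite \<Rightarrow> real^'n"
  assumes "f differentiable (at x)"
  shows "vf_apply V f x = (\<Sum>i\<in>UNIV. V x $ i *\<^sub>R frechet_derivative f (at x) (axis i 1))"
proof -
  have lin: "linear (frechet_derivative f (at x))"
    using assms by (rule linear_frechet_derivative)
  have "frechet_derivative f (at x) (V x)
      = frechet_derivative f (at x) (\<Sum>i\<in>UNIV. V x $ i *\<^sub>R axis i 1)"
    using basis_expansion[of "V x"] by (simp add: scalar_mult_eq_scaleR)
  also have "\<dots> = (\<Sum>i\<in>UNIV. V x $ i *\<^sub>R frechet_derivative f (at x) (axis i 1))"
    by (simp add: linear_sum[OF lin] linear_cmul[OF lin])
  finally show ?thesis by (simp add: vf_apply_def)
qed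

lemma Ck_on_vec_nth: 
  fixes V :: "'a::real_normed_vector \<Rightarrow> real^'n::finite"
  shows "open S \<Longrightarrow> Ck_on k S V \<Longrightarrow> Ck_on k S (\<lambda>x. V x $ i)"
  by (rule Ck_on_linear_comp) (auto intro: bounded_linear_vec_nth)

lemma Ck_on_vf_apply:
  fixes V :: "real^'n::finite \<Rightarrow> real^'n"
  assumes "open S" "Ck_on (Suc k) S f" "Ck_on k S V"
  shows "Ck_on k S (vf_apply V f)"
proof -
  have "Ck_on k S (\<lambda>x. \<Sum>i\<in>UNIV. V x $ i *\<^sub>R frechet_derivative f (at x) (axis i 1))"
    using assms(2) by (intro Ck_on_sum Ck_on_scaleR Ck_on_vec_nth assms) simp
  then show ?thesis
    by (rule Ck_on_cong_imp[OF assms(1), rotated])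
       (use assms(2) in \<open>auto simp: vf_apply_coordinates\<close>)
qed

section \<open>Integrals of compactly supported functions\<close>

lemma integrable_compact_support:
  fixes g :: "'a::euclidean_space \<Rightarrow> 'b::{banach, second_countable_topology}"
  assumes "compact K" "continuous_on K g" "\<And>x. x \<notin> K \<Longrightarrow> g x = 0"
  shows "integrable lborel g"
proof -
  have "(\<lambda>x. indicator K x *\<^sub>R g x) = g"
    using assms(3) by (auto simp: indicator_def)
  then show ?thesis using borel_integrable_compact[OF assms(1,2)] by simp
qed

lemma integral_translate:
  fixes g :: "'a::euclidean_space \<Rightarrow> real"
  assumes "g \<in> borel_measurable borel"
  shows "(\<integral>x. g (x + c) \<partial>lborel) = (\<integral>x. g x \<partial>lborel)"
proof -
  have "(\<integral>x. g x \<partial>lborel) = (\<integral>x. g x \<partial>distr lborel borel ((+) c))"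
    by (simp add: lborel_distr_plus)
  also have "\<dots> = (\<integral>x. g (c + x) \<partial>lborel)"
    using assms by (intro integral_distr) auto
  finally show ?thesis by (simp add: add.commute)
qed

text \<open>By translation invariance all difference quotients have integral zero. They converge to the
  directional derivative, and the mean value theorem dominates them by a constant on one ball.\<close>

lemma integral_directional_derivative_eq_0:
  fixes g :: "'a::euclidean_space \<Rightarrow> real"
  assumes g: "Ck_on 1 UNIV g" and K: "compact K" "\<And>x. x \<notin> K \<Longrightarrow> g x = 0"
  shows "(\<integral>x. frechet_derivative g (at x) v \<partial>lborel) = 0"
proof -
  define d where "d x = frechet_derivative g (at x) v" for x
  have der: "(g has_derivative frechet_derivative g (at x)) (at x)" for x
    using g Ck_on_Suc_has_derivative[of 0 UNIV g x] by simp
  have line: "((\<lambda>t. g (x + t *\<^sub>R v)) has_real_derivative d (x + t *\<^sub>R v)) (at t)" for x t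
  proof -
    have "((\<lambda>t. g (x + t *\<^sub>R v)) has_derivative
        (\<lambda>h. frechet_derivative g (at (x + t *\<^sub>R v)) (h *\<^sub>R v))) (at t)"
      by (rule has_derivative_compose[OF _ der]) (auto intro!: derivative_eq_intros)
    moreover have "(\<lambda>h. frechet_derivative g (at (x + t *\<^sub>R v)) (h *\<^sub>R v)) = (*) (d (x + t *\<^sub>R v))"
      using linear_cmul[OF has_derivative_linear[OF der]] by (auto simp: d_def)
    ultimately show ?thesis by (simp add: has_field_derivative_def)
  qed
  have cont_d: "continuous_on UNIV d"
    using g by (simp add: d_def)
  have "open (- K)" using K(1) by (simp add: compact_imp_closed open_Compl)
  then have "d x = 0" if "x \<notin> K" for x
    using vf_apply_locally_zero[of "- K" x g "\<lambda>_. v"] K that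
    by (auto simp: vf_apply_def d_def)
  note d0 = this
  obtain B where B: "\<And>x. \<bar>d x\<bar> \<le> B" "B \<ge> 0"
  proof -
    have "bounded (d ` K)"
      using compact_continuous_image[OF continuous_on_subset[OF cont_d] K(1)] compact_imp_bounded by auto
    then obtain B where "\<And>x. x \<in> K \<Longrightarrow> \<bar>d x\<bar> \<le> B" by (auto simp: bounded_iff)
    then have "\<bar>d x\<bar> \<le> max B 0" for x using d0[of x] by (cases "x \<in> K") force+
    then show ?thesis using that[of "max B 0"] by simp
  qed
  \<comment> \<open>All quotients with increment at most \<open>norm v\<close> are supported in the ball of radius
      \<open>r + norm v\<close>.\<close>
  obtain r where "\<forall>x\<in>K. norm x \<le> r"
    using compact_imp_bounded[OF K(1)] unfolding bounded_iff by blast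
  then have r: "K \<subseteq> cball 0 r" by auto
  have gK: "continuous_on UNIV g"
    by (rule Ck_on_imp_continuous_on[OF g])
  then have g_meas [measurable]: "g \<in> borel_measurable borel"
    by (rule borel_measurable_continuous_onI)
  have int_g: "integrable lborel g"
    using integrable_compact_support[OF K(1) continuous_on_subset[OF gK]] K(2) by auto
  have int_gt: "integrable lborel (\<lambda>x. g (x + c))" for c
  proof -
    have "compact ((\<lambda>x. x - c) ` K)"
      by (intro compact_continuous_image K continuous_intros)
    then show ?thesis
      by (rule integrable_compact_support)
         (auto intro!: continuous_on_compose2[OF gK] continuous_intros K(2) 
               simp: image_iff algebra_simps)
  qed
  define s where "s n x = (g (x + (1 / real (Suc n)) *\<^sub>R v) - g x) / (1 / real (Suc n))" for n x
  have "(\<lambda>n. \<integral>x. s n x \<partial>lborel) \<longlonglongrightarrow> (\<integral>x. d x \<partial>lborel)"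
  proof (rule integral_dominated_convergence)
    show "d \<in> borel_measurable lborel"
      using borel_measurable_continuous_onI[OF cont_d] by simp
    show "s n \<in> borel_measurable lborel" for n
      unfolding s_def by measurable
    show "integrable lborel (\<lambda>x. indicator (cball 0 (r + norm v)) x *\<^sub>R B)"
      by (rule borel_integrable_compact) auto
    show "AE x in lborel. (\<lambda>n. s n x) \<longlonglongrightarrow> d x"
    proof (rule AE_I2)
      fix x
      have "(\<lambda>h. (g (x + h *\<^sub>R v) - g x) / h) \<midarrow>0\<rightarrow> d x"
        using line[of x 0] by (simp add: DERIV_def)
      moreover have "filterlim (\<lambda>n. 1 / real (Suc n)) (at 0) sequentially"
        using LIMSEQ_inverse_real_of_nat by (auto simp: filterlim_at field_simps)
      ultimately show "(\<lambda>n. s n x) \<longlonglongrightarrow> d x"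
        unfolding s_def by (rule filterlim_compose)
    qed
    show "AE x in lborel. norm (s n x) \<le> indicator (cball 0 (r + norm v)) x *\<^sub>R B" for n
    proof (rule AE_I2)
      fix x
      define h where "h = 1 / real (Suc n)"
      have h: "0 < h" "h \<le> 1" by (auto simp: h_def)
      obtain t where t: "0 < t" "t < h" "g (x + h *\<^sub>R v) - g (x + 0 *\<^sub>R v) = (h - 0) * d (x + t *\<^sub>R v)"
        using MVT2[OF h(1) line, of x] by blast
      have s: "s n x = d (x + t *\<^sub>R v)" 
      proof -
        have "s n x = (g (x + h *\<^sub>R v) - g x) / h" by (simp only: s_def h_def)
        then show ?thesis using t h by simp
      qed
      show "norm (s n x) \<le> indicator (cball 0 (r + norm v)) x *\<^sub>R B"
      proof (cases "x \<in> cball 0 (r + norm v)")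
        case True
        then show ?thesis using B s by simp
      next
        case False
        have "norm x \<le> norm (x + t *\<^sub>R v) + norm (t *\<^sub>R v)"
          by (metis add_diff_cancel_right' norm_triangle_ineq4)
        moreover have "norm (t *\<^sub>R v) \<le> norm v"
          using t h by (simp add: mult_left_le_one_le)
        ultimately have "x + t *\<^sub>R v \<notin> K" using False r by auto
        then show ?thesis using s d0 False by simp
      qed
    qed
  qed
  moreover have "(\<integral>x. s n x \<partial>lborel) = 0" for n
    unfolding s_def using integral_translate[OF g_meas] int_g int_gt by simp
  ultimately show ?thesis
    by (simp add: d_def LIMSEQ_const_iff)
qed

lemma tendsto_integral_parameter:
  fixes H :: "real \<Rightarrow> 'a::euclidean_space \<Rightarrow> real"
  assumes H: "continuous_on ({0..1} \<times> UNIV) (\<lambda>(c, y). H c y)"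
    and K: "compact K" "\<And>c y. y \<notin> K \<Longrightarrow> H c y = 0"
  shows "(\<lambda>n. \<integral>y. H (1 / real (Suc n)) y \<partial>lborel) \<longlonglongrightarrow> (\<integral>y. H 0 y \<partial>lborel)"
proof -
  have "compact ((\<lambda>(c, y). H c y) ` ({0..1} \<times> K))"
    by (intro compact_continuous_image compact_Times K(1) compact_Icc continuous_on_subset[OF H]) auto
  then have "bounded ((\<lambda>(c, y). H c y) ` ({0..1} \<times> K))"
    by (rule compact_imp_bounded)
  then obtain B where B: "\<And>c y. c \<in> {0..1} \<Longrightarrow> y \<in> K \<Longrightarrow> \<bar>H c y\<bar> \<le> B"
    by (force simp: bounded_iff)
  have c01: "1 / real (Suc n) \<in> {0..1}" for n by simp
  have cont: "continuous_on UNIV (H c)" if "c \<in> {0..1}" for c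
  proof -
    have "continuous_on UNIV (\<lambda>y. (\<lambda>(c, y). H c y) (c, y))"
      by (rule continuous_on_compose2[OF H]) (use that in \<open>auto intro!: continuous_intros\<close>)
    then show ?thesis by simp
  qed
  show ?thesis
  proof (rule integral_dominated_convergence)
    show "H 0 \<in> borel_measurable lborel"
      using borel_measurable_continuous_onI[OF cont[of 0]] by simp
    show "H (1 / real (Suc n)) \<in> borel_measurable lborel" for n
      using borel_measurable_continuous_onI[OF cont[OF c01]] by simp
    show "integrable lborel (\<lambda>x. indicator K x *\<^sub>R B)"
      by (rule borel_integrable_compact) (use K in auto)
    show "AE y in lborel. norm (H (1 / real (Suc n)) y) \<le> indicator K y *\<^sub>R B" for n
      using B[OF c01] K(2) by (intro AE_I2) (auto simp: indicator_def)
    show "AE y in lborel. (\<lambda>n. H (1 / real (Suc n)) y) \<longlonglongrightarrow> H 0 y"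
    proof (rule AE_I2)
      fix y
      have "continuous_on {0..1} (\<lambda>c. (\<lambda>(c, y). H c y) (c, y))"
        by (rule continuous_on_compose2[OF H]) (auto intro!: continuous_intros)
      then have "continuous_on {0..1} (\<lambda>c. H c y)" by simp
      moreover have "(\<lambda>n. 1 / real (Suc n)) \<longlonglongrightarrow> 0"
        using LIMSEQ_inverse_real_of_nat by (simp add: inverse_eq_divide)
      ultimately show "(\<lambda>n. H (1 / real (Suc n)) y) \<longlonglongrightarrow> H 0 y"
        using c01 by (intro continuous_on_tendsto_compose[of "{0..1}" "\<lambda>c. H c y"]) auto
    qed
  qed
qed

lemma integral_diagonal_scaling:
  fixes f :: "real^'n::finite \<Rightarrow> real"
  assumes c: "\<And>i. c i \<noteq> 0" and f: "f \<in> borel_measurable borel"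
  shows "(\<integral>x. f x \<partial>lborel) = (\<Prod>i\<in>UNIV. \<bar>c i\<bar>) * (\<integral>x. f (\<chi> i. c i * x $ i) \<partial>lborel)"
proof -
  \<comment> \<open>The factors \<open>c\<close> re-indexed by basis vectors instead of coordinates.\<close>
  define b where "b = (\<lambda>j::real^'n. \<Sum>i\<in>UNIV. j $ i * c i)"
  have b: "b (axis i 1) = c i" for i
    by (simp add: b_def axis_def mult_delta_left)
  define T where "T = (\<lambda>x::real^'n. \<chi> i. c i * x $ i)"
  have Basis: "(Basis :: (real^'n) set) = range (\<lambda>i. axis i 1)"
    by (auto simp: Basis_vec_def)
  have inj: "inj (\<lambda>i. axis i 1 :: real^'n)"
    by (auto simp: inj_on_def axis_eq_axis)
  have T: "(\<lambda>x. 0 + (\<Sum>j\<in>Basis. (b j * (x \<bullet> j)) *\<^sub>R j)) = T"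
  proof
    fix x :: "real^'n"
    have "(\<Sum>j\<in>Basis. (b j * (x \<bullet> j)) *\<^sub>R j) = (\<Sum>i\<in>UNIV. (c i * x $ i) *\<^sub>R axis i 1)"
      unfolding Basis by (subst sum.reindex[OF inj]) (simp add: b inner_axis)
    also have "\<dots> = T x"
      using basis_expansion[of "T x"] by (simp add: T_def scalar_mult_eq_scaleR)
    finally show "0 + (\<Sum>j\<in>Basis. (b j * (x \<bullet> j)) *\<^sub>R j) = T x" by simp
  qed
  have b0: "b j \<noteq> 0" if "j \<in> Basis" for j
  proof -
    from that obtain i where "j = axis i 1" unfolding Basis by (rule imageE)
    then show ?thesis using b c by simp
  qed
  have P: "(\<Prod>j\<in>Basis. \<bar>b j\<bar>) = (\<Prod>i\<in>UNIV. \<bar>c i\<bar>)"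
    unfolding Basis by (subst prod.reindex[OF inj]) (simp add: b)
  have "lborel = density (distr lborel borel T) (\<lambda>_. (\<Prod>i\<in>UNIV. \<bar>c i\<bar>))"
    using lborel_affine_euclidean[of b 0, OF b0] unfolding T P .
  then have "(\<integral>x. f x \<partial>lborel) = (\<integral>x. f x \<partial>density (distr lborel borel T) (\<lambda>_. (\<Prod>i\<in>UNIV. \<bar>c i\<bar>)))"
    by simp
  also have "\<dots> = (\<integral>x. (\<Prod>i\<in>UNIV. \<bar>c i\<bar>) *\<^sub>R f x \<partial>distr lborel borel T)"
    using f by (intro integral_density) (auto intro!: AE_I2 prod_nonneg)
  also have "\<dots> = (\<integral>x. (\<Prod>i\<in>UNIV. \<bar>c i\<bar>) *\<^sub>R f (T x) \<partial>lborel)"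
  proof (rule integral_distr)
    have "continuous_on UNIV T" unfolding T_def by (intro continuous_intros)
    then show "T \<in> measurable lborel borel"
      by (simp add: borel_measurable_continuous_onI)
  qed (use f in auto)
  finally show ?thesis by (simp add: T_def)
qed

section \<open>A smooth step on the real line\<close>

definition flat :: "real \<Rightarrow> real" where
  "flat t = (if t > 0 then exp (- inverse t) else 0)"

lemma poly_over_exp_tendsto_0: "((\<lambda>y. poly p y / exp y) \<longlongrightarrow> (0::real)) at_top"
proof -
  have "((\<lambda>y. \<Sum>i\<le>degree p. coeff p i * (y ^ i / exp y)) \<longlongrightarrow> (\<Sum>i\<le>degree p. coeff p i * 0)) at_top"
    by (intro tendsto_sum tendsto_mult tendsto_const tendsto_power_div_exp_0)
  then show ?thesis by (simp add: poly_altdef sum_divide_distrib)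
qed

text \<open>On the right half-line the chain rule gives the polynomial \<open>y\<^sup>2 (p - p')\<close> in \<open>y = 1/t\<close>. At the
  origin the difference quotient has the same form with \<open>y p\<close> instead of \<open>p\<close>, and tends to zero
  because the exponential beats every polynomial.\<close>

lemma has_real_derivative_flat:
  defines "F \<equiv> \<lambda>p t. if t > 0 then poly p (inverse t) * exp (- inverse t) else (0::real)"
  shows "(F p has_real_derivative F (monom 1 2 * (p - pderiv p)) t) (at t)"
proof -
  consider "t > 0" | "t < 0" | "t = 0" by linarith
  then show ?thesis
  proof cases
    case 1
    have "((\<lambda>t. poly p (inverse t) * exp (- inverse t)) has_real_derivative
        F (monom 1 2 * (p - pderiv p)) t) (at t)"
      using 1 unfolding F_def
      by (auto intro!: derivative_eq_intros DERIV_chain2[OF poly_DERIV]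
            simp: poly_monom power2_eq_square algebra_simps)
    then show ?thesis
      by (rule has_field_derivative_transform_within_open[of _ _ _ "{0<..}"]) (use 1 in \<open>auto simp: F_def\<close>)
  next
    case 2
    have "((\<lambda>t. 0) has_real_derivative F (monom 1 2 * (p - pderiv p)) t) (at t)"
      using 2 by (auto simp: F_def)
    then show ?thesis
      by (rule has_field_derivative_transform_within_open[of _ _ _ "{..<0}"]) (use 2 in \<open>auto simp: F_def\<close>)
  next
    case 3
    have "((\<lambda>h. F p h / h) \<longlongrightarrow> 0) (at_left 0)"
      by (rule tendsto_eventually) (auto simp: F_def eventually_at_filter)
    moreover have "((\<lambda>h. F p h / h) \<longlongrightarrow> 0) (at_right 0)"
    proof (rule Lim_transform_eventually)
      show "((\<lambda>h. poly (pCons 0 p) (inverse h) / exp (inverse h)) \<longlongrightarrow> 0) (at_right (0::real))"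
        by (rule filterlim_compose[OF poly_over_exp_tendsto_0 filterlim_inverse_at_top_right])
      show "\<forall>\<^sub>F h in at_right 0. poly (pCons 0 p) (inverse h) / exp (inverse h) = F p h / h"
        by (auto simp: F_def eventually_at_filter exp_minus field_simps)
    qed
    ultimately have "((\<lambda>h. F p h / h) \<longlongrightarrow> 0) (at 0)"
      by (rule filterlim_split_at)
    moreover have "F r 0 = 0" for r by (simp add: F_def)
    ultimately show ?thesis
      using 3 by (simp add: DERIV_def)
  qed
qed

lemma Ck_on_flat: "Ck_on k UNIV flat"
proof -
  define F where "F = (\<lambda>p t. if t > 0 then poly p (inverse t) * exp (- inverse t) else (0::real))"
  have "flat = F 1" by (auto simp: F_def flat_def)
  moreover have "\<exists>g'\<in>range F. \<forall>y\<in>UNIV. (g has_real_derivative g' y) (at y)" if "g \<in> range F" for g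
  proof -
    obtain p where "g = F p" using \<open>g \<in> range F\<close> by blast
    then have "\<forall>y\<in>UNIV. (g has_real_derivative F (monom 1 2 * (p - pderiv p)) y) (at y)"
      using has_real_derivative_flat[of p] unfolding F_def by simp
    then show ?thesis by blast
  qed
  ultimately show ?thesis
    using Ck_on_derivative_closed[of UNIV "range F" flat k] by auto
qed

text \<open>The denominator is positive everywhere. Its reciprocal is a real power, so that smoothness of
  powers applies.\<close>

definition smooth_step :: "real \<Rightarrow> real" where
  "smooth_step t = flat t * (flat t + flat (1 - t)) powr (- 1)"

lemma smooth_step_eq_0: "t \<le> 0 \<Longrightarrow> smooth_step t = 0"
  by (simp add: smooth_step_def flat_def)

lemma smooth_step_eq_1: "t \<ge> 1 \<Longrightarrow> smooth_step t = 1"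
  by (simp add: smooth_step_def flat_def powr_minus)

lemma Ck_on_smooth_step: "Ck_on k UNIV smooth_step"
proof -
  have flat': "Ck_on k UNIV (\<lambda>t. flat (1 - t))"
    by (intro Ck_on_compose_real[OF _ Ck_on_flat] Ck_on_diff Ck_on_const
        Ck_on_bounded_linear[OF bounded_linear_ident]) auto
  have "flat t + flat (1 - t) > 0" for t
    by (simp add: flat_def add_pos_pos)
  then have "Ck_on k UNIV (\<lambda>t. (flat t + flat (1 - t)) powr (- 1))"
    by (intro Ck_on_compose_real[OF _ Ck_on_powr] Ck_on_add Ck_on_flat flat') auto
  then show ?thesis
    unfolding smooth_step_def by (intro Ck_on_mult Ck_on_flat) auto
qed

section \<open>Horizontal vector fields of a stratified group\<close>

definition horiz_sq :: "('n::finite \<Rightarrow> nat) \<Rightarrow> real^'n \<Rightarrow> real" where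
  "horiz_sq w x = (\<Sum>i\<in>first_stratum w. (x $ i)\<^sup>2)"

lemma horiz_sq_nonneg: "horiz_sq w x \<ge> 0"
  by (simp add: horiz_sq_def sum_nonneg)

lemma horizontal_norm_eq: "horizontal_norm w x = sqrt (horiz_sq w x)"
  by (simp add: horizontal_norm_def L2_set_def horiz_sq_def)

lemma horizontal_norm_nonzero_iff: "horizontal_norm w x \<noteq> 0 \<longleftrightarrow> horiz_sq w x > 0"
  using horiz_sq_nonneg[of w x] by (simp add: horizontal_norm_eq less_le)

lemma Ck_on_coordinate: "Ck_on k S (\<lambda>x::real^'n::finite. x $ i)"
  by (rule Ck_on_bounded_linear) (rule bounded_linear_vec_nth)

lemma Ck_on_horiz_sq: "open S \<Longrightarrow> Ck_on k S (horiz_sq w)"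
  unfolding horiz_sq_def power2_eq_square by (intro Ck_on_sum Ck_on_mult Ck_on_coordinate)

lemma continuous_on_horiz_sq: "continuous_on S (horiz_sq w)"
  unfolding horiz_sq_def by (intro continuous_intros)

lemma open_horiz_sq_pos: "open {x. horiz_sq w x > 0}"
  by (intro open_Collect_less continuous_on_horiz_sq continuous_intros)

lemma Ck_on_horiz_sq_powr: "Ck_on k {x. horiz_sq w x > 0} (\<lambda>x. horiz_sq w x powr s)"
  by (rule Ck_on_compose_real[OF open_horiz_sq_pos Ck_on_powr Ck_on_horiz_sq[OF open_horiz_sq_pos]]) auto

lemma has_derivative_horiz_sq:
  "(horiz_sq w has_derivative (\<lambda>v. \<Sum>i\<in>first_stratum w. 2 * x $ i * v $ i)) (at x)"
  unfolding horiz_sq_def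
  by (auto intro!: derivative_eq_intros bounded_linear_imp_has_derivative bounded_linear_vec_nth
      simp: mult_ac)

lemma bounded_linear_dilation: "bounded_linear (dilation w c)"
  by (intro linear_conv_bounded_linear[THEN iffD1] linearI)
     (auto simp: dilation_def vec_eq_iff algebra_simps)

lemma dilation_axis: "dilation w c (axis k a) = (c ^ w k) *\<^sub>R axis k a"
  by (auto simp: dilation_def vec_eq_iff axis_def)

lemma isCont_dilation: "isCont (\<lambda>c. dilation w c x) c"
  unfolding dilation_def isCont_def by (intro vec_tendstoI) (auto intro!: tendsto_intros)

context stratified_group
begin

lemma weight_pos: "w i \<ge> 1"
  using strata by (metis atLeastAtMost_iff rangeI)

lemma dilation_0: "dilation w 0 x = 0"
  using weight_pos by (simp add: dilation_def vec_eq_iff Suc_le_eq)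

text \<open>Dilations are automorphisms, so they fix the neutral element; doubling fixes the origin only.\<close>

lemma mul_0_right: "mul x 0 = x"
proof -
  obtain e i where "group mul e i" using lie_group unfolding lie_group_op_def by blast
  then interpret G: group mul e i .
  have "mul (dilation w 2 e) (dilation w 2 e) = mul (dilation w 2 e) e"
    using dilation_hom[of 2 e e] by simp
  then have e: "dilation w 2 e = e" by (rule G.left_cancel[THEN iffD1])
  have "e $ j = 0" for j
  proof -
    have "2 ^ w j * e $ j = e $ j" using e by (simp add: dilation_def vec_eq_iff)
    moreover have "(1::real) < 2 ^ w j"
      using weight_pos[of j] by (intro one_less_power) auto
    ultimately show ?thesis by simp
  qed
  then have "e = 0" by (simp add: vec_eq_iff)
  then show ?thesis using G.right_neutral by simp
qed

lemma mul_differentiable: "mul x differentiable (at y)"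
proof -
  have "smooth_on UNIV (\<lambda>(x, y). mul x y)" using lie_group unfolding lie_group_op_def by blast
  then have "Ck_on 1 UNIV (\<lambda>(x, y). mul x y)" by (simp add: smooth_on_def del: One_nat_def)
  then have "(\<lambda>(x, y). mul x y) differentiable (at (x, y))" by simp
  moreover have "(\<lambda>y. (x, y)) differentiable (at y)"
    by (rule differentiableI) (auto intro!: derivative_eq_intros)
  ultimately show ?thesis
    using differentiable_chain_at[of "\<lambda>y. (x, y)" y "\<lambda>(x, y). mul x y"] by (simp add: o_def)
qed

text \<open>By left invariance \<open>X\<^sub>k(x)\<close> is the derivative at the origin of left translation by \<open>x\<close> in
  direction \<open>k\<close>. Differentiate the homomorphism property of the dilation in this direction, on
  which it acts as multiplication by \<open>c\<close>.\<close>

lemma X_homogeneous: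
  assumes k: "k \<in> first_stratum w" and c: "c > 0"
  shows "c *\<^sub>R X k (dilation w c x) = dilation w c (X k x)"
proof -
  define L where "L x = frechet_derivative (mul x) (at 0)" for x
  have der: "(mul x has_derivative L x) (at 0)" for x
    using mul_differentiable by (simp add: L_def frechet_derivative_works[symmetric])
  have X_eq: "L x (axis k 1) = X k x" for x
    using left_invariant_X[OF k] X_at_0[OF k] mul_0_right unfolding left_invariant_def L_def by metis
  have lin: "bounded_linear (dilation w c)" by (rule bounded_linear_dilation)
  have d0: "dilation w c 0 = 0" using lin by (simp add: linear_simps)
  have "((\<lambda>y. dilation w c (mul x y)) has_derivative (\<lambda>v. dilation w c (L x v))) (at 0)"
    by (rule bounded_linear.has_derivative[OF lin der])
  moreover have "((\<lambda>y. mul (dilation w c x) (dilation w c y)) has_derivative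
      (\<lambda>v. L (dilation w c x) (dilation w c v))) (at 0)"
    by (rule has_derivative_compose[OF bounded_linear_imp_has_derivative[OF lin]]) (simp add: d0 der)
  ultimately have "(\<lambda>v. dilation w c (L x v)) = (\<lambda>v. L (dilation w c x) (dilation w c v))"
    using dilation_hom[OF c] has_derivative_unique by auto
  then have "dilation w c (L x (axis k 1)) = L (dilation w c x) (c *\<^sub>R axis k 1)"
    using k dilation_axis[of w c k 1] by (metis (mono_tags) mem_Collect_eq power_one_right)
  then show ?thesis
    using linear_cmul[OF has_derivative_linear[OF der]] X_eq by simp
qed

lemma X_homogeneous_nth:
  assumes "k \<in> first_stratum w" "c > 0"
  shows "c * X k (dilation w c x) $ i = c ^ w i * X k x $ i"
  using arg_cong[OF X_homogeneous[OF assms, of x], of "\<lambda>v. v $ i"] by (simp add: dilation_def)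

lemma Ck_on_X: "k \<in> first_stratum w \<Longrightarrow> Ck_on m UNIV (X k)"
  using left_invariant_X by (simp add: left_invariant_def smooth_on_def)

text \<open>Dilations contract every point to the origin. A continuous function of degree zero is therefore
  constant, and one of negative degree vanishes.\<close>

lemma tendsto_dilation_0:
  assumes "continuous_on UNIV g"
  shows "(\<lambda>n. g (dilation w (1 / real (Suc n)) x)) \<longlonglongrightarrow> g 0"
proof -
  have "(\<lambda>n. 1 / real (Suc n)) \<longlonglongrightarrow> 0"
    using LIMSEQ_inverse_real_of_nat by (simp add: inverse_eq_divide)
  then have "(\<lambda>n. dilation w (1 / real (Suc n)) x) \<longlonglongrightarrow> dilation w 0 x"
    by (rule isCont_tendsto_compose[OF isCont_dilation])
  then show ?thesis
    using assms by (intro isCont_tendsto_compose[of 0 g]) (auto simp: dilation_0 continuous_on_eq_continuous_at)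
qed

text \<open>This coefficient of \<open>X\<^sub>k\<close> is homogeneous of degree zero, hence equal to its value at the origin.\<close>

lemma X_first_stratum:
  assumes k: "k \<in> first_stratum w" and i: "i \<in> first_stratum w"
  shows "X k x $ i = (if i = k then 1 else 0)"
proof -
  have "continuous_on UNIV (\<lambda>x. X k x $ i)"
    using Ck_on_imp_continuous_on[OF Ck_on_X[OF k, of 0]] by (intro continuous_intros)
  from tendsto_dilation_0[OF this, of x]
  have "(\<lambda>n. X k x $ i) \<longlonglongrightarrow> X k 0 $ i"
    using X_homogeneous_nth[OF k, of "1 / real (Suc _)" x i] i by simp
  then have "X k x $ i = X k 0 $ i" by (simp add: LIMSEQ_const_iff)
  then show ?thesis using X_at_0[OF k] by (simp add: axis_def)
qed

text \<open>The coefficient has degree \<open>w i - 1\<close> and differentiation in direction \<open>i\<close> lowers the degree by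
  \<open>w i\<close>. The derivative is thus a continuous function of degree \<open>-1\<close>.\<close>

lemma X_divergence_free:
  assumes k: "k \<in> first_stratum w"
  shows "frechet_derivative (\<lambda>x. X k x $ i) (at x) (axis i 1) = 0"
proof -
  define g where "g x = X k x $ i" for x
  have g: "Ck_on 1 UNIV g" unfolding g_def by (intro Ck_on_vec_nth Ck_on_X k open_UNIV)
  define D where "D x = frechet_derivative g (at x) (axis i 1)" for x
  have der: "(g has_derivative frechet_derivative g (at x)) (at x)" for x
    using g Ck_on_Suc_has_derivative[of 0 UNIV g x] by simp
  have D: "c * D (dilation w c x) = D x" if c: "c > 0" for c
  proof -
    have "((\<lambda>y. c * g (dilation w c y)) has_derivative
       (\<lambda>v. c * frechet_derivative g (at (dilation w c x)) (dilation w c v))) (at x)"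
      by (intro has_derivative_mult_right has_derivative_compose[OF _ der]
          bounded_linear_imp_has_derivative bounded_linear_dilation)
    moreover have "((\<lambda>y. c ^ w i * g y) has_derivative (\<lambda>v. c ^ w i * frechet_derivative g (at x) v)) (at x)"
      by (intro has_derivative_mult_right der)
    moreover have "(\<lambda>y. c * g (dilation w c y)) = (\<lambda>y. c ^ w i * g y)"
      using X_homogeneous_nth[OF k c] by (simp add: g_def)
    ultimately have "(\<lambda>v. c * frechet_derivative g (at (dilation w c x)) (dilation w c v))
        = (\<lambda>v. c ^ w i * frechet_derivative g (at x) v)"
      using has_derivative_unique by auto
    then have "c * frechet_derivative g (at (dilation w c x)) (dilation w c (axis i 1)) = c ^ w i * D x"
      unfolding D_def by (rule fun_cong)
    then have "c ^ w i * (c * D (dilation w c x)) = c ^ w i * D x"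
      by (simp add: dilation_axis linear_cmul[OF has_derivative_linear[OF der]] D_def)
    then show ?thesis using c by simp
  qed
  have "continuous_on UNIV D" using g by (simp add: D_def)
  from tendsto_dilation_0[OF this, of x]
  have "(\<lambda>n. D (dilation w (1 / real (Suc n)) x)) \<longlonglongrightarrow> D 0" .
  moreover have "(\<lambda>n. 1 / real (Suc n)) \<longlonglongrightarrow> 0"
    using LIMSEQ_inverse_real_of_nat by (simp add: inverse_eq_divide)
  ultimately have "(\<lambda>n. 1 / real (Suc n) * D (dilation w (1 / real (Suc n)) x)) \<longlonglongrightarrow> 0 * D 0"
    by (intro tendsto_mult)
  moreover have "1 / real (Suc n) * D (dilation w (1 / real (Suc n)) x) = D x" for n
    by (rule D) simp
  ultimately have "(\<lambda>n. D x) \<longlonglongrightarrow> 0" by simp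
  then have "D x = 0" by (simp add: LIMSEQ_const_iff)
  then show ?thesis by (simp add: D_def g_def[abs_def])
qed

text \<open>As \<open>X\<^sub>k\<close> has no divergence, \<open>X\<^sub>k g\<close> is the sum of the partial derivatives of the products of
  \<open>g\<close> with the coefficients of \<open>X\<^sub>k\<close>.\<close>

lemma integral_X_eq_0:
  assumes k: "k \<in> first_stratum w" and g: "Ck_on 1 UNIV g"
    and K: "compact K" "\<And>x. x \<notin> K \<Longrightarrow> g x = (0::real)"
  shows "(\<integral>x. vf_apply (X k) g x \<partial>lborel) = 0"
proof -
  define h where "h i x = X k x $ i * g x" for i x
  have h: "Ck_on 1 UNIV (h i)" for i
    unfolding h_def by (intro Ck_on_mult Ck_on_vec_nth Ck_on_X k open_UNIV g)
  have h0: "h i x = 0" if "x \<notin> K" for i x using K that by (simp add: h_def)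
  have openK: "open (- K)" using K(1) by (simp add: compact_imp_closed open_Compl)
  have int: "integrable lborel (\<lambda>x. frechet_derivative (h i) (at x) (axis i 1))" for i
  proof (rule integrable_compact_support[OF K(1)])
    show "continuous_on K (\<lambda>x. frechet_derivative (h i) (at x) (axis i 1))"
      using h[of i] by (auto intro: continuous_on_subset)
    show "frechet_derivative (h i) (at x) (axis i 1) = 0" if "x \<notin> K" for x
      using vf_apply_locally_zero[OF openK, of x "h i" "\<lambda>_. axis i 1"] h0 that
      by (simp add: vf_apply_def)
  qed
  have "vf_apply (X k) g x = (\<Sum>i\<in>UNIV. frechet_derivative (h i) (at x) (axis i 1))" for x
  proof -
    have dg: "g differentiable (at x)" using g by simp
    have "frechet_derivative (h i) (at x) (axis i 1)
        = X k x $ i *\<^sub>R frechet_derivative g (at x) (axis i 1)" for i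
    proof -
      have "(\<lambda>x. X k x $ i) differentiable (at x)"
        using Ck_on_vec_nth[OF open_UNIV Ck_on_X[OF k, of 1], of i] by simp
      from vf_apply_mult[OF this dg, of "\<lambda>_. axis i 1"] show ?thesis
        using X_divergence_free[OF k, of i x] by (simp add: vf_apply_def h_def[abs_def])
    qed
    then show ?thesis using vf_apply_coordinates[OF dg] by simp
  qed
  then have "(\<integral>x. vf_apply (X k) g x \<partial>lborel)
      = (\<Sum>i\<in>UNIV. \<integral>x. frechet_derivative (h i) (at x) (axis i 1) \<partial>lborel)"
    using int by simp
  also have "\<dots> = 0"
    using integral_directional_derivative_eq_0[OF h K(1) h0] by simp
  finally show ?thesis .
qed

lemma X_coordinate:
  assumes "k \<in> first_stratum w" "i \<in> first_stratum w"
  shows "vf_apply (X k) (\<lambda>x. x $ i) x = (if i = k then 1 else 0)"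
  using vf_apply_eq[OF bounded_linear_imp_has_derivative[OF bounded_linear_vec_nth], of "X k" i x]
    X_first_stratum[OF assms] by simp

lemma X_horiz_sq:
  assumes "k \<in> first_stratum w"
  shows "vf_apply (X k) (horiz_sq w) x = 2 * x $ k"
proof -
  have "vf_apply (X k) (horiz_sq w) x = (\<Sum>i\<in>first_stratum w. 2 * x $ i * X k x $ i)"
    by (rule vf_apply_eq[OF has_derivative_horiz_sq])
  also have "\<dots> = (\<Sum>i\<in>first_stratum w. if i = k then 2 * x $ i else 0)"
    by (intro sum.cong) (use assms X_first_stratum in auto)
  finally show ?thesis using assms by simp
qed

end

section \<open>The inequality\<close>

lemma test_functionsE:
  assumes "f \<in> test_functions U"
  obtains K where "compact K" "K \<subseteq> U" "\<And>x. x \<notin> K \<Longrightarrow> f x = 0" "\<And>m. Ck_on m UNIV f"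
proof
  show "compact (closure {x. f x \<noteq> 0})" "closure {x. f x \<noteq> 0} \<subseteq> U" "Ck_on m UNIV f" for m
    using assms by (auto simp: test_functions_def smooth_on_def)
  show "f x = 0" if "x \<notin> closure {x. f x \<noteq> 0}" for x
    using that closure_subset[of "{x. f x \<noteq> 0}"] by auto
qed

text \<open>The identity of the integrands extends to \<open>x' = 0\<close> because there both \<open>0 powr d\<close> and division by
  zero return zero.\<close>

lemma L2_norm_weighted:
  "L2_norm (\<lambda>x. g x / of_real (horizontal_norm w x powr d))
    = sqrt (\<integral>x. (norm (g x))\<^sup>2 * horiz_sq w x powr (- d) \<partial>lborel)"
proof -
  have "(norm (g x / of_real (horizontal_norm w x powr d)))\<^sup>2 = (norm (g x))\<^sup>2 * horiz_sq w x powr (- d)" for x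
  proof (cases "horiz_sq w x = 0")
    case True
    then show ?thesis by (simp add: horizontal_norm_eq)
  next
    case False
    then have q: "horiz_sq w x > 0" using horiz_sq_nonneg[of w x] by simp
    have "(horizontal_norm w x powr d)\<^sup>2 = horiz_sq w x powr d"
      using q by (simp add: horizontal_norm_eq powr_half_sqrt[symmetric] powr_powr powr_power)
    then show ?thesis
      by (simp add: norm_divide power_divide powr_minus field_simps)
  qed
  then show ?thesis by (simp add: L2_norm_def)
qed

text \<open>The algebra behind the inequality, with \<open>a k\<close>, \<open>l\<close>, \<open>y\<close>, \<open>q\<close> in the roles of \<open>X\<^sub>k f\<close>, \<open>L f\<close>, \<open>x'\<close>,
  \<open>|x'|\<^sup>2\<close>. The term subtracted on the left becomes a divergence later. Up to the factor \<open>p\<close>, the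
  right side minus the left side is the square norm of \<open>q l + C f\<close> plus a nonnegative multiple of
  the Hardy square \<open>\<Sum>k. |a k + \<gamma> (y k / q) f|\<^sup>2\<close>; the relation between \<open>C\<close>, \<open>\<beta>\<close>, \<open>\<gamma>\<close> makes the
  remaining multiples of \<open>|f|\<^sup>2\<close> cancel.\<close>

lemma rellich_pointwise:
  fixes a :: "'i \<Rightarrow> 'b::real_inner" and l f :: 'b and y :: "'i \<Rightarrow> real"
  assumes q: "q = (\<Sum>k\<in>I. (y k)\<^sup>2)" "q > 0" and p: "p \<ge> 0"
    and C: "C = \<gamma> * (2 * \<beta> - \<gamma>)" "C \<ge> 0"
  shows "C\<^sup>2 * ((f \<bullet> f) * p) - 2 * C * (((\<Sum>k\<in>I. a k \<bullet> a k) * q + (l \<bullet> f) * q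
            + 2 * \<gamma> * (\<Sum>k\<in>I. y k * (a k \<bullet> f)) + 2 * \<beta> * \<gamma> * (f \<bullet> f)) * p)
         \<le> (l \<bullet> l) * (q\<^sup>2 * p)"
proof -
  define G where "G = (\<Sum>k\<in>I. a k \<bullet> a k)"
  define E where "E = (\<Sum>k\<in>I. y k * (a k \<bullet> f))"
  have "0 \<le> (\<Sum>k\<in>I. (q *\<^sub>R a k + (\<gamma> * y k) *\<^sub>R f) \<bullet> (q *\<^sub>R a k + (\<gamma> * y k) *\<^sub>R f))"
    by (intro sum_nonneg) simp
  also have "\<dots> = (\<Sum>k\<in>I. q\<^sup>2 * (a k \<bullet> a k) + 2 * \<gamma> * q * (y k * (a k \<bullet> f)) + \<gamma>\<^sup>2 * (f \<bullet> f) * (y k)\<^sup>2)"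
    by (intro sum.cong) (simp_all add: inner_add inner_commute power2_eq_square algebra_simps)
  also have "\<dots> = q * (q * G + 2 * \<gamma> * E + \<gamma>\<^sup>2 * (f \<bullet> f))"
    unfolding G_def E_def
    by (simp add: sum.distrib sum_distrib_left[symmetric] q(1)[symmetric])
       (simp add: power2_eq_square algebra_simps)
  finally have 1: "0 \<le> q * G + 2 * \<gamma> * E + \<gamma>\<^sup>2 * (f \<bullet> f)"
    using q(2) by (simp add: zero_le_mult_iff)
  have "0 \<le> (q *\<^sub>R l + C *\<^sub>R f) \<bullet> (q *\<^sub>R l + C *\<^sub>R f)" by simp
  also have "\<dots> = (l \<bullet> l) * q\<^sup>2 + 2 * C * (l \<bullet> f) * q + C\<^sup>2 * (f \<bullet> f)"
    by (simp add: inner_add inner_commute power2_eq_square algebra_simps)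
  finally have 2: "0 \<le> (l \<bullet> l) * q\<^sup>2 + 2 * C * (l \<bullet> f) * q + C\<^sup>2 * (f \<bullet> f)" .
  have "(l \<bullet> l) * q\<^sup>2 - (C\<^sup>2 * (f \<bullet> f) - 2 * C * (G * q + (l \<bullet> f) * q + 2 * \<gamma> * E + 2 * \<beta> * \<gamma> * (f \<bullet> f)))
     = ((l \<bullet> l) * q\<^sup>2 + 2 * C * (l \<bullet> f) * q + C\<^sup>2 * (f \<bullet> f))
       + 2 * C * (q * G + 2 * \<gamma> * E + \<gamma>\<^sup>2 * (f \<bullet> f))
       + 2 * C * (f \<bullet> f) * (2 * \<beta> * \<gamma> - \<gamma>\<^sup>2 - C)"
    by (simp add: power2_eq_square algebra_simps)
  also have "2 * \<beta> * \<gamma> - \<gamma>\<^sup>2 - C = 0"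
    by (simp add: C(1) power2_eq_square algebra_simps)
  also have "((l \<bullet> l) * q\<^sup>2 + 2 * C * (l \<bullet> f) * q + C\<^sup>2 * (f \<bullet> f))
       + 2 * C * (q * G + 2 * \<gamma> * E + \<gamma>\<^sup>2 * (f \<bullet> f)) + 2 * C * (f \<bullet> f) * 0 \<ge> 0"
    using 2 mult_nonneg_nonneg[OF _ 1, of "2 * C"] C(2) by simp
  finally have "C\<^sup>2 * (f \<bullet> f) - 2 * C * (G * q + (l \<bullet> f) * q + 2 * \<gamma> * E + 2 * \<beta> * \<gamma> * (f \<bullet> f))
      \<le> (l \<bullet> l) * q\<^sup>2" by simp
  from mult_right_mono[OF this p] show ?thesis
    by (simp add: G_def E_def algebra_simps)
qed

context stratified_group
begin

lemma Ck_on_X_apply: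
  assumes "k \<in> first_stratum w" "open U" "Ck_on (Suc m) U f"
  shows "Ck_on m U (vf_apply (X k) f)"
  by (rule Ck_on_vf_apply[OF assms(2,3)]) (rule Ck_on_subset[OF Ck_on_X[OF assms(1)]], simp)

lemma Ck_on_sub_laplacian:
  assumes "open U" "Ck_on (Suc (Suc m)) U f"
  shows "Ck_on m U (sub_laplacian w X f)"
proof -
  have "Ck_on m U (\<lambda>x. \<Sum>k\<in>first_stratum w. vf_apply (X k) (vf_apply (X k) f) x)"
    by (rule Ck_on_sum[OF assms(1)]) (rule Ck_on_X_apply[OF _ assms(1)], assumption,
        rule Ck_on_X_apply[OF _ assms(1)], assumption, rule assms(2))
  then show ?thesis unfolding sub_laplacian_def .
qed

lemma sub_laplacian_locally_zero:
  assumes "open U" "x \<in> U" "\<And>y. y \<in> U \<Longrightarrow> f y = 0"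
  shows "sub_laplacian w X f x = 0"
  unfolding sub_laplacian_def
  by (intro sum.neutral ballI vf_apply_locally_zero[OF assms(1,2)] vf_apply_locally_zero[OF assms(1) _ assms(3)])

text \<open>Integrate the pointwise inequality for a suitable choice of \<open>g\<^sub>k\<close>. The first part of \<open>g\<^sub>k\<close> moves
  one derivative from \<open>L f\<close> to \<open>f\<close>, the second is the field used in the proof of Hardy's
  inequality.\<close>

lemma rellich_integral_inequality:
  fixes \<delta> :: real
  assumes f: "f \<in> test_functions {x. horizontal_norm w x \<noteq> 0}"
    and C: "C = (real (card (first_stratum w)) - 2 * \<delta> - 4) * (real (card (first_stratum w)) + 2 * \<delta>) / 4"
      "C \<ge> 0"
  shows "C\<^sup>2 * (\<integral>x. (norm (f x))\<^sup>2 * horiz_sq w x powr (- (\<delta> + 2)) \<partial>lborel)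
    \<le> (\<integral>x. (norm (sub_laplacian w X f x))\<^sup>2 * horiz_sq w x powr (- \<delta>) \<partial>lborel)"
proof -
  define N where "N = real (card (first_stratum w))"
  \<comment> \<open>\<open>\<gamma>\<close> is the Hardy exponent of the weight \<open>|x'| powr (2 * s)\<close>. The choice of \<open>\<beta>\<close>
      satisfies \<open>s + \<beta> = \<gamma>\<close>, which gives the cross terms the coefficient required to
      complete the square.\<close>
  define \<beta> where "\<beta> = N / 2 - 1"
  define \<gamma> where "\<gamma> = (N - 2 * \<delta> - 4) / 2"
  define s where "s = - \<delta> - 1"
  have C': "C = \<gamma> * (2 * \<beta> - \<gamma>)"
    unfolding C(1) \<beta>_def \<gamma>_def N_def[symmetric] by (simp add: field_simps)
  define U where "U = {x. horiz_sq w x > 0}"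
  have U: "open U" unfolding U_def by (rule open_horiz_sq_pos)
  obtain K where K: "compact K" "K \<subseteq> U" and f0: "\<And>x. x \<notin> K \<Longrightarrow> f x = 0" and fC: "\<And>m. Ck_on m UNIV f"
    using f by (elim test_functionsE) (auto simp: U_def horizontal_norm_nonzero_iff)
  have oK: "open (- K)" using K(1) by (simp add: compact_imp_closed open_Compl)
  have UK: "U \<union> - K = UNIV" using K by auto
  define q where "q = horiz_sq w"
  define a where "a k = vf_apply (X k) f" for k
  define l where "l = sub_laplacian w X f"
  have aC: "Ck_on m UNIV (a k)" if "k \<in> first_stratum w" for k m
    unfolding a_def by (rule Ck_on_X_apply[OF that open_UNIV fC])
  have lC: "Ck_on m UNIV l" for m
    unfolding l_def by (rule Ck_on_sub_laplacian[OF open_UNIV fC])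
  have a0: "a k x = 0" if "x \<notin> K" for k x
    unfolding a_def by (rule vf_apply_locally_zero[OF oK]) (use that f0 in auto)
  have l0: "l x = 0" if "x \<notin> K" for x
    unfolding l_def by (rule sub_laplacian_locally_zero[OF oK]) (use that f0 in auto)
  define g where "g k x = (a k x \<bullet> f x) * q x powr s + \<beta> * ((f x \<bullet> f x) * (x $ k * q x powr (s - 1)))" for k x
  have g0: "g k x = 0" if "x \<notin> K" for k x using f0 that by (simp add: g_def)
  have gC: "Ck_on m UNIV (g k)" if k: "k \<in> first_stratum w" for k m
  proof -
    have "Ck_on m U (g k)"
      unfolding g_def q_def
      by (intro Ck_on_add Ck_on_mult Ck_on_inner U Ck_on_const Ck_on_coordinate
          Ck_on_horiz_sq_powr[of _ w, folded U_def] Ck_on_subset[OF aC[OF k]] Ck_on_subset[OF fC] subset_UNIV)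
    moreover have "Ck_on m (- K) (g k)"
      by (rule Ck_on_cong_imp[OF oK _ Ck_on_const[of _ _ 0]]) (use g0 in auto)
    ultimately show ?thesis using Ck_on_open_Un[OF U oK] UK by metis
  qed
  have diff_f: "f differentiable (at x)" and diff_a: "k \<in> first_stratum w \<Longrightarrow> a k differentiable (at x)" for x k
    using fC[of 1] aC[of k 1] by simp_all
  have div: "(\<Sum>k\<in>first_stratum w. vf_apply (X k) (g k) x)
      = ((\<Sum>k\<in>first_stratum w. a k x \<bullet> a k x) * q x + (l x \<bullet> f x) * q x
            + 2 * \<gamma> * (\<Sum>k\<in>first_stratum w. x $ k * (a k x \<bullet> f x)) + 2 * \<beta> * \<gamma> * (f x \<bullet> f x))
        * q x powr (s - 1)" if x: "x \<in> U" for x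
  proof -
    have qx: "q x > 0" using x by (simp add: U_def q_def)
    have diff_q: "q differentiable (at x)" 
      unfolding q_def using has_derivative_horiz_sq differentiableI by blast
    have diff_c: "(\<lambda>x. x $ k) differentiable (at x)" for k
      using bounded_linear_imp_differentiable[OF bounded_linear_vec_nth] .
    define p where "p = q x powr (s - 1)"
    have p: "q x powr s = q x * p" "q x * q x powr (s - 1 - 1) = p"
      using qx by (simp_all add: p_def powr_diff power2_eq_square)
    have der: "((\<lambda>y. y powr r) has_real_derivative r * q x powr (r - 1)) (at (q x))" for r
      using qx by (auto intro!: derivative_eq_intros)
    have diff_p: "(\<lambda>x. q x powr r) differentiable (at x)" for r
      using Ck_on_horiz_sq_powr[of 1 w r] x by (simp add: U_def q_def)
    have Xp: "vf_apply (X k) (\<lambda>x. q x powr r) x = r * q x powr (r - 1) * (2 * x $ k)"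
      if "k \<in> first_stratum w" for k r
      using vf_apply_compose_real[OF der diff_q] X_horiz_sq[OF that] by (simp add: q_def)
    have "vf_apply (X k) (g k) x = (a k x \<bullet> a k x) * (q x * p) + (vf_apply (X k) (a k) x \<bullet> f x) * (q x * p)
        + 2 * (s + \<beta>) * (x $ k * (a k x \<bullet> f x)) * p
        + \<beta> * (f x \<bullet> f x) * p
        + 2 * \<beta> * (s - 1) * (f x \<bullet> f x) * (x $ k)\<^sup>2 * q x powr (s - 1 - 1)"
      if k: "k \<in> first_stratum w" for k
    proof -
      have 1: "vf_apply (X k) (\<lambda>x. (a k x \<bullet> f x) * q x powr s) x
          = (a k x \<bullet> f x) * (s * p * (2 * x $ k)) + (a k x \<bullet> a k x + vf_apply (X k) (a k) x \<bullet> f x) * (q x * p)"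
        by (subst vf_apply_mult)
           (auto simp: vf_apply_inner diff_f diff_a[OF k] diff_p Xp[OF k] p p_def[symmetric] a_def[symmetric]
             intro: differentiable_inner)
      have 2: "vf_apply (X k) (\<lambda>x. x $ k * q x powr (s - 1)) x
          = x $ k * ((s - 1) * q x powr (s - 1 - 1) * (2 * x $ k)) + p"
        by (subst vf_apply_mult) (auto simp: diff_c diff_p Xp[OF k] p_def[symmetric] X_coordinate[OF k k])
      have 3: "vf_apply (X k) (\<lambda>x. f x \<bullet> f x) x = 2 * (a k x \<bullet> f x)"
        by (subst vf_apply_inner) (auto simp: diff_f a_def[symmetric] inner_commute)
      have d: "(\<lambda>x. x $ k * q x powr (s - 1)) differentiable (at x)"
        by (intro differentiable_mult diff_c diff_p)
      have 4: "vf_apply (X k) (\<lambda>x. \<beta> * ((f x \<bullet> f x) * (x $ k * q x powr (s - 1)))) x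
        = \<beta> * ((f x \<bullet> f x) * (x $ k * ((s - 1) * q x powr (s - 1 - 1) * (2 * x $ k)) + p)
            + 2 * (a k x \<bullet> f x) * (x $ k * p))"
        by (subst vf_apply_linear[OF bounded_linear_mult_right])
           (auto simp: vf_apply_mult[OF _ d] differentiable_inner diff_f 2 3 p_def[symmetric]
             intro!: differentiable_mult d)
      have "vf_apply (X k) (g k) x
        = vf_apply (X k) (\<lambda>x. (a k x \<bullet> f x) * q x powr s) x
          + vf_apply (X k) (\<lambda>x. \<beta> * ((f x \<bullet> f x) * (x $ k * q x powr (s - 1)))) x"
        unfolding g_def
        by (intro vf_apply_add differentiable_mult differentiable_inner differentiable_const diff_f diff_a[OF k] diff_p d)
      then show ?thesis unfolding 1 4 by (simp add: algebra_simps power2_eq_square)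
    qed
    then have "(\<Sum>k\<in>first_stratum w. vf_apply (X k) (g k) x)
      = (\<Sum>k\<in>first_stratum w. (a k x \<bullet> a k x) * (q x * p) + (vf_apply (X k) (a k) x \<bullet> f x) * (q x * p)
        + 2 * (s + \<beta>) * (x $ k * (a k x \<bullet> f x)) * p
        + \<beta> * (f x \<bullet> f x) * p
        + 2 * \<beta> * (s - 1) * (f x \<bullet> f x) * (x $ k)\<^sup>2 * q x powr (s - 1 - 1))"
      by (intro sum.cong) auto
    also have "\<dots> = (\<Sum>k\<in>first_stratum w. a k x \<bullet> a k x) * (q x * p)
        + (l x \<bullet> f x) * (q x * p)
        + 2 * (s + \<beta>) * (\<Sum>k\<in>first_stratum w. x $ k * (a k x \<bullet> f x)) * p
        + N * (\<beta> * (f x \<bullet> f x) * p)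
        + 2 * \<beta> * (s - 1) * (f x \<bullet> f x) * q x * q x powr (s - 1 - 1)"
      unfolding l_def sub_laplacian_def a_def[symmetric]
      by (simp add: sum.distrib sum_distrib_left[symmetric] sum_distrib_right[symmetric]
          inner_sum_left N_def q_def)
         (simp add: horiz_sq_def)
    also have "2 * \<beta> * (s - 1) * (f x \<bullet> f x) * q x * q x powr (s - 1 - 1) = 2 * \<beta> * (s - 1) * (f x \<bullet> f x) * p"
      using p(2) by (simp add: mult.assoc)
    also have "s + \<beta> = \<gamma>" by (simp add: s_def \<beta>_def \<gamma>_def field_simps)
    also have "N = 2 * \<gamma> - 2 * (s - 1)" by (simp add: s_def \<gamma>_def field_simps)
    finally show ?thesis by (simp add: p_def[symmetric] algebra_simps)
  qed
  define P where "P x = (norm (l x))\<^sup>2 * q x powr (- \<delta>)" for x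
  define F where "F x = (norm (f x))\<^sup>2 * q x powr (- (\<delta> + 2))" for x
  define D where "D x = (\<Sum>k\<in>first_stratum w. vf_apply (X k) (g k) x)" for x
  \<comment> \<open>Outside the support of \<open>f\<close>, in particular at \<open>x' = 0\<close>, all terms are zero.\<close>
  have pw: "C\<^sup>2 * F x - 2 * C * D x \<le> P x" for x
  proof (cases "x \<in> K")
    case True
    then have x: "x \<in> U" using K by auto
    then have qx: "q x > 0" by (simp add: U_def q_def)
    have "- \<delta> = 2 + (s - 1)" "- (\<delta> + 2) = s - 1" by (simp_all add: s_def)
    then have e: "q x powr (- \<delta>) = (q x)\<^sup>2 * q x powr (s - 1)"
        "q x powr (- (\<delta> + 2)) = q x powr (s - 1)"
      using qx powr_add[of "q x" 2 "s - 1"] by (simp_all only:) simp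
    show ?thesis
      unfolding P_def F_def D_def e div[OF x] power2_norm_eq_inner
      by (rule rellich_pointwise[OF _ qx _ C' C(2)]) (simp_all add: q_def horiz_sq_def)
  next
    case False
    have "vf_apply (X k) (g k) x = 0" for k
      by (rule vf_apply_locally_zero[OF oK]) (use False g0 in auto)
    then show ?thesis using False f0 l0 by (simp add: P_def F_def D_def)
  qed
  have cq: "continuous_on K (\<lambda>x. q x powr r)" for r
    using Ck_on_imp_continuous_on[OF Ck_on_horiz_sq_powr[of 0 w r]] K(2)
    unfolding q_def U_def by (rule continuous_on_subset)
  have cont: "continuous_on K f" "continuous_on K l"
    using Ck_on_imp_continuous_on[OF fC[of 0]] Ck_on_imp_continuous_on[OF lC[of 0]]
    by (auto intro: continuous_on_subset)
  have intP: "integrable lborel P"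
    by (rule integrable_compact_support[OF K(1)])
       (auto simp: P_def l0 intro!: continuous_intros cont cq)
  have intF: "integrable lborel F"
    by (rule integrable_compact_support[OF K(1)])
       (auto simp: F_def f0 intro!: continuous_intros cont cq[of "- (\<delta> + 2)", simplified])
  have intX: "integrable lborel (vf_apply (X k) (g k))" if k: "k \<in> first_stratum w" for k
  proof (rule integrable_compact_support[OF K(1)])
    show "continuous_on K (vf_apply (X k) (g k))"
      using Ck_on_imp_continuous_on[OF Ck_on_X_apply[OF k open_UNIV gC[OF k, of "Suc 0"]]]
      by (rule continuous_on_subset) simp
    show "vf_apply (X k) (g k) x = 0" if "x \<notin> K" for x
      by (rule vf_apply_locally_zero[OF oK]) (use that g0 in auto)
  qed
  have intD: "integrable lborel D"
    unfolding D_def by (intro Bochner_Integration.integrable_sum intX)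
  have "(\<integral>x. D x \<partial>lborel) = (\<Sum>k\<in>first_stratum w. \<integral>x. vf_apply (X k) (g k) x \<partial>lborel)"
    unfolding D_def by (intro Bochner_Integration.integral_sum intX)
  also have "\<dots> = 0"
    by (intro sum.neutral ballI integral_X_eq_0[OF _ gC K(1) g0])
  finally have D0: "(\<integral>x. D x \<partial>lborel) = 0" .
  have "(\<integral>x. C\<^sup>2 * F x - 2 * C * D x \<partial>lborel) \<le> (\<integral>x. P x \<partial>lborel)"
    by (intro integral_mono intP Bochner_Integration.integrable_diff integrable_mult_right intF intD pw)
  also have "(\<integral>x. C\<^sup>2 * F x - 2 * C * D x \<partial>lborel) = C\<^sup>2 * (\<integral>x. F x \<partial>lborel)"
    using intF intD D0 by simp
  finally show ?thesis by (simp add: P_def F_def l_def q_def)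
qed

end

section \<open>Radial functions\<close>

definition vert_sq :: "('n::finite \<Rightarrow> nat) \<Rightarrow> real^'n \<Rightarrow> real" where
  "vert_sq w x = (\<Sum>i\<in>- first_stratum w. (x $ i)\<^sup>2)"

definition cutoff :: "('n::finite \<Rightarrow> nat) \<Rightarrow> real^'n \<Rightarrow> real" where
  "cutoff w x = flat (1 - vert_sq w x)"

text \<open>That is, \<open>|x'| powr (-2a)\<close> times a profile in the variable \<open>ln |x'|\<^sup>2\<close>. A profile that
  vanishes on the negative half-line makes the function zero for \<open>|x'| < 1\<close>, and thus smooth across
  \<open>x' = 0\<close>.\<close>

definition radial :: "('n::finite \<Rightarrow> nat) \<Rightarrow> real \<Rightarrow> (real \<Rightarrow> real) \<Rightarrow> real^'n \<Rightarrow> real" where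
  "radial w a h x = horiz_sq w x powr (- a) * h (ln (horiz_sq w x))"

lemma continuous_on_vert_sq: "continuous_on S (vert_sq w)"
  unfolding vert_sq_def by (intro continuous_intros)

lemma cutoff_eq_0: "vert_sq w x \<ge> 1 \<Longrightarrow> cutoff w x = 0"
  by (simp add: cutoff_def flat_def)

lemma Ck_on_cutoff: "Ck_on k UNIV (cutoff w)"
  unfolding cutoff_def vert_sq_def power2_eq_square
  by (intro Ck_on_compose_real[OF _ Ck_on_flat] Ck_on_diff Ck_on_const Ck_on_sum Ck_on_mult
      Ck_on_coordinate) auto

lemma horiz_sq_scale: "(\<And>i. i \<in> first_stratum w \<Longrightarrow> c i = 1) \<Longrightarrow> horiz_sq w (\<chi> i. c i * x $ i) = horiz_sq w x"
  unfolding horiz_sq_def by (intro sum.cong) auto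

lemma vert_sq_scale: "(\<And>i. i \<notin> first_stratum w \<Longrightarrow> c i = 1) \<Longrightarrow> vert_sq w (\<chi> i. c i * x $ i) = vert_sq w x"
  unfolding vert_sq_def by (intro sum.cong) auto

text \<open>In the sharpness argument all integrands are supported, after rescaling in the higher strata, in
  an annulus in \<open>x'\<close> times a ball in the remaining variables.\<close>

lemma compact_annulus: "compact {x. 1 \<le> horiz_sq w x \<and> horiz_sq w x \<le> b \<and> vert_sq w x \<le> 1}"
proof -
  have "closed {x. 1 \<le> horiz_sq w x \<and> horiz_sq w x \<le> b \<and> vert_sq w x \<le> 1}"
    by (intro closed_Collect_conj closed_Collect_le continuous_on_horiz_sq continuous_on_vert_sq continuous_intros)
  moreover have "norm x \<le> sqrt (b + 1)" if "horiz_sq w x \<le> b" "vert_sq w x \<le> 1" for x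
  proof -
    have "horiz_sq w x + vert_sq w x = (\<Sum>i\<in>UNIV. (x $ i)\<^sup>2)"
      unfolding horiz_sq_def vert_sq_def by (subst sum.union_disjoint[symmetric]) (auto intro: sum.cong)
    then have "norm x = sqrt (horiz_sq w x + vert_sq w x)"
      by (simp add: norm_vec_def L2_set_def)
    then show ?thesis using that by simp
  qed
  then have "bounded {x. 1 \<le> horiz_sq w x \<and> horiz_sq w x \<le> b \<and> vert_sq w x \<le> 1}"
    by (auto simp: bounded_iff)
  ultimately show ?thesis by (simp add: compact_eq_bounded_closed)
qed

lemma radial_eq_0:
  assumes "\<And>t. t < 0 \<Longrightarrow> h t = 0" "horiz_sq w x < 1"
  shows "radial w a h x = 0"
proof (cases "horiz_sq w x = 0")
  case False
  then have "ln (horiz_sq w x) < 0" using assms(2) horiz_sq_nonneg[of w x] by simp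
  then show ?thesis using assms(1) by (simp add: radial_def)
qed (simp add: radial_def)

lemma open_horiz_sq_less: "open {x. horiz_sq w x < 1}"
  by (intro open_Collect_less continuous_on_horiz_sq continuous_intros)

lemma Ck_on_radial:
  assumes "Ck_on k UNIV h" "\<And>t. t < 0 \<Longrightarrow> h t = 0"
  shows "Ck_on k UNIV (radial w a h)"
proof -
  define U where "U = {x. horiz_sq w x > 0}"
  have U: "open U" unfolding U_def by (rule open_horiz_sq_pos)
  have "Ck_on k U (\<lambda>x. ln (horiz_sq w x))"
    by (rule Ck_on_compose_real[OF U Ck_on_ln Ck_on_horiz_sq[OF U]]) (auto simp: U_def)
  then have "Ck_on k U (radial w a h)"
    unfolding radial_def
    by (intro Ck_on_mult[OF U] Ck_on_horiz_sq_powr[of _ w, folded U_def] Ck_on_compose_real[OF U assms(1)]) auto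
  moreover have "Ck_on k {x. horiz_sq w x < 1} (radial w a h)"
    by (rule Ck_on_cong_imp[OF open_horiz_sq_less _ Ck_on_const[of _ _ 0]]) (use radial_eq_0 assms(2) in auto)
  ultimately have "Ck_on k (U \<union> {x. horiz_sq w x < 1}) (radial w a h)"
    by (intro Ck_on_open_Un[OF U open_horiz_sq_less])
  moreover have "U \<union> {x. horiz_sq w x < 1} = UNIV" by (auto simp: U_def)
  ultimately show ?thesis by simp
qed

context stratified_group
begin

text \<open>The test functions for sharpness are real-valued, and products of them are easier to
  differentiate before they are embedded into the complex numbers.\<close>

definition real_sub_laplacian :: "(real^'n \<Rightarrow> real) \<Rightarrow> real^'n \<Rightarrow> real" where
  "real_sub_laplacian u x = (\<Sum>k\<in>first_stratum w. vf_apply (X k) (vf_apply (X k) u) x)"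

lemma Ck_on_real_sub_laplacian:
  assumes "\<And>m. Ck_on m UNIV u"
  shows "Ck_on m UNIV (real_sub_laplacian u)"
proof -
  have "Ck_on m UNIV (\<lambda>x. \<Sum>k\<in>first_stratum w. vf_apply (X k) (vf_apply (X k) u) x)"
    by (intro Ck_on_sum Ck_on_X_apply open_UNIV assms)
  then show ?thesis unfolding real_sub_laplacian_def .
qed

lemma sub_laplacian_of_real:
  assumes u: "\<And>m. Ck_on m UNIV u"
  shows "sub_laplacian w X (\<lambda>x. of_real (u x)) x = of_real (real_sub_laplacian u x)"
proof -
  have "u differentiable (at x)" for x using u[of 1] by simp
  then have 1: "vf_apply (X k) (\<lambda>x. complex_of_real (u x)) = (\<lambda>x. of_real (vf_apply (X k) u x))" for k
    by (intro ext vf_apply_linear[OF bounded_linear_of_real])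
  have "vf_apply (X k) u differentiable (at x)" if "k \<in> first_stratum w" for k
    using Ck_on_X_apply[OF that open_UNIV u, of 1] by simp
  then have "vf_apply (X k) (\<lambda>x. complex_of_real (vf_apply (X k) u x)) x
      = of_real (vf_apply (X k) (vf_apply (X k) u) x)" if "k \<in> first_stratum w" for k
    using that by (intro vf_apply_linear[OF bounded_linear_of_real])
  then show ?thesis by (simp add: sub_laplacian_def real_sub_laplacian_def 1)
qed

lemma real_sub_laplacian_mult:
  assumes u: "\<And>m. Ck_on m UNIV u" and v: "\<And>m. Ck_on m UNIV v"
  shows "real_sub_laplacian (\<lambda>x. u x * v x) x = real_sub_laplacian u x * v x
    + 2 * (\<Sum>k\<in>first_stratum w. vf_apply (X k) u x * vf_apply (X k) v x) + u x * real_sub_laplacian v x"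
proof -
  have du: "u differentiable (at x)" and dv: "v differentiable (at x)" for x
    using u[of 1] v[of 1] by simp_all
  have 1: "vf_apply (X k) (\<lambda>x. u x * v x) = (\<lambda>x. u x * vf_apply (X k) v x + vf_apply (X k) u x * v x)" for k
    by (intro ext vf_apply_mult du dv)
  have "vf_apply (X k) (vf_apply (X k) (\<lambda>x. u x * v x)) x =
      vf_apply (X k) (vf_apply (X k) u) x * v x
      + 2 * (vf_apply (X k) u x * vf_apply (X k) v x) + u x * vf_apply (X k) (vf_apply (X k) v) x"
    if k: "k \<in> first_stratum w" for k
  proof -
    have d: "vf_apply (X k) u differentiable (at x)" "vf_apply (X k) v differentiable (at x)"
      using Ck_on_X_apply[OF k open_UNIV u, of 1] Ck_on_X_apply[OF k open_UNIV v, of 1] by simp_all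
    show ?thesis
      unfolding 1
      by (simp add: vf_apply_add vf_apply_mult differentiable_mult du dv d)
  qed
  then show ?thesis
    by (simp add: real_sub_laplacian_def sum.distrib sum_distrib_left sum_distrib_right)
qed

text \<open>Homogeneity of \<open>X\<^sub>k\<close> read on functions. This is the gain that makes slowly varying cutoffs in the
  higher strata harmless.\<close>

lemma X_dilation:
  assumes k: "k \<in> first_stratum w" and c: "c > 0" and u: "u differentiable (at (dilation w c x))"
  shows "vf_apply (X k) (\<lambda>x. u (dilation w c x)) x = c * vf_apply (X k) u (dilation w c x)"
proof -
  define y where "y = dilation w c x"
  have der: "(u has_derivative frechet_derivative u (at y)) (at y)"
    using u by (simp add: y_def frechet_derivative_works)
  have "vf_apply (X k) (\<lambda>x. u (dilation w c x)) x = frechet_derivative u (at y) (dilation w c (X k x))"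
    unfolding y_def
    by (rule vf_apply_eq[OF has_derivative_compose[OF bounded_linear_imp_has_derivative[OF bounded_linear_dilation]]])
       (use der in \<open>simp add: y_def\<close>)
  also have "\<dots> = frechet_derivative u (at y) (c *\<^sub>R X k y)"
    using X_homogeneous[OF k c, of x] by (simp add: y_def)
  also have "\<dots> = c * frechet_derivative u (at y) (X k y)"
    using linear_cmul[OF has_derivative_linear[OF der]] by simp
  finally show ?thesis by (simp add: vf_apply_def y_def)
qed

lemma real_sub_laplacian_dilation:
  assumes c: "c > 0" and u: "\<And>m. Ck_on m UNIV u"
  shows "real_sub_laplacian (\<lambda>x. u (dilation w c x)) x = c\<^sup>2 * real_sub_laplacian u (dilation w c x)"
proof -
  have du: "u differentiable (at x)" for x using u[of 1] by simp
  have "vf_apply (X k) (vf_apply (X k) (\<lambda>x. u (dilation w c x))) x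
      = c\<^sup>2 * vf_apply (X k) (vf_apply (X k) u) (dilation w c x)"
    if k: "k \<in> first_stratum w" for k
  proof -
    have Xu: "Ck_on 1 UNIV (vf_apply (X k) u)"
      using Ck_on_X_apply[OF k open_UNIV u, of 1] by simp
    have 1: "vf_apply (X k) (\<lambda>x. u (dilation w c x)) = (\<lambda>x. c * vf_apply (X k) u (dilation w c x))"
      by (intro ext X_dilation[OF k c] du)
    have "(\<lambda>x. vf_apply (X k) u (dilation w c x)) differentiable (at x)"
      using Ck_on_comp_linear[OF bounded_linear_dilation Xu] by simp
    then have "vf_apply (X k) (\<lambda>x. c * vf_apply (X k) u (dilation w c x)) x
        = c * vf_apply (X k) (\<lambda>x. vf_apply (X k) u (dilation w c x)) x"
      by (rule vf_apply_linear[OF bounded_linear_mult_right])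
    also have "\<dots> = c\<^sup>2 * vf_apply (X k) (vf_apply (X k) u) (dilation w c x)"
      using X_dilation[OF k c, of "vf_apply (X k) u"] Xu by (simp add: power2_eq_square)
    finally show ?thesis unfolding 1 .
  qed
  then show ?thesis by (simp add: real_sub_laplacian_def sum_distrib_left)
qed

text \<open>The chain rule, as \<open>X\<^sub>k |x'|\<^sup>2 = 2 x\<^sub>k\<close>. The result is \<open>x\<^sub>k\<close> times another radial function, so that
  the rule can be iterated; at \<open>x' = 0\<close> both sides are zero.\<close>

lemma X_radial:
  assumes k: "k \<in> first_stratum w" and h: "\<And>t. (h has_real_derivative h' t) (at t)"
    and h0: "\<And>t. t < 0 \<Longrightarrow> h t = 0"
  shows "vf_apply (X k) (radial w a h) x = 2 * x $ k * radial w (a + 1) (\<lambda>t. h' t - a * h t) x"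
proof (cases "horiz_sq w x = 0")
  case True
  then have "vf_apply (X k) (radial w a h) x = 0"
    by (intro vf_apply_locally_zero[OF open_horiz_sq_less[of w]]) (use radial_eq_0 h0 in auto)
  then show ?thesis using True by (simp add: radial_def)
next
  case False
  define q where "q = horiz_sq w x"
  have q: "q > 0" using False horiz_sq_nonneg[of w x] by (simp add: q_def)
  have "((\<lambda>y. y powr (- a) * h (ln y)) has_real_derivative
      q powr (- (a + 1)) * (h' (ln q) - a * h (ln q))) (at q)"
  proof -
    have "((\<lambda>y. h (ln y)) has_real_derivative h' (ln q) * (1 / q)) (at q)"
      by (rule DERIV_chain2[OF h]) (use q in \<open>auto intro!: derivative_eq_intros\<close>)
    moreover have "((\<lambda>y. y powr (- a)) has_real_derivative - a * q powr (- a - 1)) (at q)"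
      using q by (auto intro!: derivative_eq_intros)
    ultimately have "((\<lambda>y. y powr (- a) * h (ln y)) has_real_derivative
        q powr (- a) * (h' (ln q) * (1 / q)) + - a * q powr (- a - 1) * h (ln q)) (at q)"
      by (rule DERIV_mult'[rotated])
    moreover have "- (a + 1) = - a - 1" by simp
    moreover have "q powr (- a - 1) = q powr (- a) / q"
      using q powr_diff[of q "- a" 1] by simp
    ultimately show ?thesis by (simp only:) (simp add: algebra_simps)
  qed
  moreover have "horiz_sq w differentiable (at x)"
    using has_derivative_horiz_sq differentiableI by blast
  ultimately have "vf_apply (X k) (\<lambda>x. horiz_sq w x powr (- a) * h (ln (horiz_sq w x))) x
      = q powr (- (a + 1)) * (h' (ln q) - a * h (ln q)) * vf_apply (X k) (horiz_sq w) x"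
    unfolding q_def by (rule vf_apply_compose_real)
  then show ?thesis
    using X_horiz_sq[OF k] by (simp add: radial_def[abs_def] q_def)
qed

text \<open>Apply the previous lemma twice and sum over \<open>k\<close>. In the logarithmic variable the operator has
  constant coefficients; the coefficient of the undifferentiated profile is what will become the
  sharp constant.\<close>

lemma real_sub_laplacian_radial:
  fixes a :: real
  defines "N \<equiv> real (card (first_stratum w))"
  assumes h: "\<And>t. (h has_real_derivative h' t) (at t)" "\<And>t. (h' has_real_derivative h'' t) (at t)"
    and C1: "Ck_on 1 UNIV h" "Ck_on 1 UNIV h'"
    and h0: "\<And>t. t < 0 \<Longrightarrow> h t = 0"
  shows "real_sub_laplacian (radial w a h) x
    = radial w (a + 1) (\<lambda>t. 4 * h'' t + (2 * N - 8 * a - 4) * h' t - a * (2 * N - 4 * a - 4) * h t) x"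
proof -
  define h1 where "h1 t = h' t - a * h t" for t
  define h2 where "h2 t = h'' t - a * h' t" for t
  have h'0: "h' t = 0" if "t < 0" for t
    by (rule derivative_locally_constant[OF h(1), of "{..<0}"]) (use that h0 in auto)
  have h10: "h1 t = 0" if "t < 0" for t
    using that h0 h'0 by (simp add: h1_def)
  have d1: "(h1 has_real_derivative h2 t) (at t)" for t
    unfolding h1_def h2_def by (auto intro!: derivative_eq_intros h)
  have C1: "Ck_on 1 UNIV h1"
    unfolding h1_def by (intro Ck_on_diff Ck_on_mult Ck_on_const C1 open_UNIV)
  have R: "radial w (a + 1) h1 differentiable (at x)" for x
    using Ck_on_radial[OF C1 h10, of w "a + 1"] by simp
  have "vf_apply (X k) (vf_apply (X k) (radial w a h)) x
      = 2 * radial w (a + 1) h1 x + 4 * radial w (a + 2) (\<lambda>t. h2 t - (a + 1) * h1 t) x * (x $ k)\<^sup>2"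
    if k: "k \<in> first_stratum w" for k
  proof -
    have 1: "vf_apply (X k) (radial w a h) = (\<lambda>x. 2 * (x $ k * radial w (a + 1) h1 x))"
      using X_radial[OF k h(1) h0] by (intro ext) (simp add: h1_def[abs_def])
    have c: "(\<lambda>x. x $ k) differentiable (at x)"
      using bounded_linear_imp_differentiable[OF bounded_linear_vec_nth] .
    have "vf_apply (X k) (\<lambda>x. 2 * (x $ k * radial w (a + 1) h1 x)) x
        = 2 * vf_apply (X k) (\<lambda>x. x $ k * radial w (a + 1) h1 x) x"
      by (rule vf_apply_linear[OF bounded_linear_mult_right]) (intro differentiable_mult c R)
    also have "vf_apply (X k) (\<lambda>x. x $ k * radial w (a + 1) h1 x) x
        = x $ k * vf_apply (X k) (radial w (a + 1) h1) x + radial w (a + 1) h1 x"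
      by (subst vf_apply_mult[OF c R]) (simp add: X_coordinate[OF k k])
    also have "vf_apply (X k) (radial w (a + 1) h1) x
        = 2 * x $ k * radial w (a + 2) (\<lambda>t. h2 t - (a + 1) * h1 t) x"
      using X_radial[OF k d1 h10, of "a + 1" x] by (simp add: add.commute[of 2 a])
    finally show ?thesis unfolding 1 by (simp add: power2_eq_square algebra_simps)
  qed
  then have "real_sub_laplacian (radial w a h) x = 2 * N * radial w (a + 1) h1 x
      + 4 * (horiz_sq w x * radial w (a + 2) (\<lambda>t. h2 t - (a + 1) * h1 t) x)"
    by (simp add: real_sub_laplacian_def sum.distrib sum_distrib_left[symmetric] N_def horiz_sq_def)
  also have "horiz_sq w x * radial w (a + 2) (\<lambda>t. h2 t - (a + 1) * h1 t) x
      = radial w (a + 1) (\<lambda>t. h2 t - (a + 1) * h1 t) x"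
  proof (cases "horiz_sq w x = 0")
    case False
    then have "horiz_sq w x * horiz_sq w x powr (- (a + 2)) = horiz_sq w x powr (- (a + 1))"
    proof -
      have "horiz_sq w x powr (1 + - (a + 2)) = horiz_sq w x * horiz_sq w x powr (- (a + 2))"
        using False horiz_sq_nonneg[of w x] by (simp only: powr_add) simp
      moreover have "1 + - (a + 2) = - (a + 1)" by simp
      ultimately show ?thesis by (simp only:)
    qed
    then show ?thesis by (simp add: radial_def)
  qed (simp add: radial_def)
  also have "2 * N * radial w (a + 1) h1 x + 4 * radial w (a + 1) (\<lambda>t. h2 t - (a + 1) * h1 t) x
      = radial w (a + 1) (\<lambda>t. 4 * h'' t + (2 * N - 8 * a - 4) * h' t - a * (2 * N - 4 * a - 4) * h t) x"
    by (simp add: radial_def h1_def h2_def algebra_simps)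
  finally show ?thesis .
qed

section \<open>Two-scale test functions\<close>

text \<open>Test the inequality with \<open>\<phi> \<cdot> (\<psi> \<circ> dilation w c)\<close>, where \<open>\<phi>\<close> is radial and \<open>\<psi>\<close> is the cutoff in the higher
  strata. The linear substitution that undoes the dilation in the higher strata multiplies both
  sides by the same Jacobian, and leaves \<open>\<phi>\<close> and its derivatives along \<open>X\<^sub>k\<close> unchanged, as they
  depend on \<open>x'\<close> only. What remains is a continuous function of \<open>(c, y)\<close> with fixed compact
  support, whose value at \<open>c = 0\<close> contains no derivative of \<open>\<psi>\<close>.\<close>

lemma rellich_two_scale_limit:
  fixes \<delta> a L B :: real
  assumes ineq: "\<And>f. f \<in> test_functions {x. horizontal_norm w x \<noteq> 0} \<Longrightarrow>
      B * L2_norm (\<lambda>x. f x / of_real (horizontal_norm w x powr (\<delta> + 2)))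
      \<le> L2_norm (\<lambda>x. sub_laplacian w X f x / of_real (horizontal_norm w x powr \<delta>))"
    and B: "B \<ge> 0" and \<delta>: "\<delta> < 0"
    and h: "\<And>m. Ck_on m UNIV h" "\<And>t. t \<notin> {0..L} \<Longrightarrow> h t = 0"
  shows "B\<^sup>2 * (\<integral>x. (radial w a h x * cutoff w x)\<^sup>2 * horiz_sq w x powr (- (\<delta> + 2)) \<partial>lborel)
    \<le> (\<integral>x. (real_sub_laplacian (radial w a h) x * cutoff w x)\<^sup>2 * horiz_sq w x powr (- \<delta>) \<partial>lborel)"
proof -
  define \<phi> where "\<phi> = radial w a h"
  define \<psi> where "\<psi> = cutoff w"
  define K where "K = {x. 1 \<le> horiz_sq w x \<and> horiz_sq w x \<le> exp L \<and> vert_sq w x \<le> 1}"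
  define A where "A = {x. 1 \<le> horiz_sq w x \<and> horiz_sq w x \<le> exp L}"
  have K: "compact K" unfolding K_def by (rule compact_annulus)
  have h0: "h t = 0" if "t < 0" for t using h(2) that by simp
  have \<phi>C: "Ck_on m UNIV \<phi>" for m unfolding \<phi>_def by (intro Ck_on_radial h h0)
  have \<psi>C: "Ck_on m UNIV \<psi>" for m unfolding \<psi>_def by (rule Ck_on_cutoff)
  obtain h' where h': "\<And>t. (h has_real_derivative h' t) (at t)" "\<And>m. Ck_on m UNIV h'"
    using Ck_on_real_derivative[OF h(1)] by blast
  obtain h'' where h'': "\<And>t. (h' has_real_derivative h'' t) (at t)" "\<And>m. Ck_on m UNIV h''"
    using Ck_on_real_derivative[OF h'(2)] by blast
  have \<phi>0: "\<phi> x = 0" if "x \<notin> A" for x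
  proof (cases "horiz_sq w x < 1")
    case True
    then show ?thesis unfolding \<phi>_def by (intro radial_eq_0 h0)
  next
    case False
    then have "exp L < horiz_sq w x" using that by (auto simp: A_def)
    moreover from this have "0 < horiz_sq w x" using exp_gt_zero[of L] by linarith
    ultimately have "ln (exp L) < ln (horiz_sq w x)" by (subst ln_less_cancel_iff) auto
    then have "L < ln (horiz_sq w x)" by simp
    then show ?thesis using h(2) by (simp add: \<phi>_def radial_def)
  qed
  have \<psi>0: "\<psi> x = 0" if "vert_sq w x > 1" for x
    using that by (simp add: \<psi>_def cutoff_eq_0)
  have oA: "open (- A)"
    unfolding A_def by (intro open_Compl closed_Collect_conj closed_Collect_le continuous_on_horiz_sq continuous_intros)
  have X\<phi>0: "vf_apply (X k) \<phi> x = 0" if "x \<notin> A" for x k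
    by (rule vf_apply_locally_zero[OF oA]) (use that \<phi>0 in auto)
  have L\<phi>0: "real_sub_laplacian \<phi> x = 0" if "x \<notin> A" for x
    unfolding real_sub_laplacian_def
    by (intro sum.neutral ballI vf_apply_locally_zero[OF oA]) (use that \<phi>0 in auto)
  have oB: "open {x. vert_sq w x > 1}"
    by (intro open_Collect_less continuous_on_vert_sq continuous_intros)
  have X\<psi>0: "vf_apply (X k) \<psi> x = 0" if "vert_sq w x > 1" for x k
    by (rule vf_apply_locally_zero[OF oB]) (use that \<psi>0 in auto)
  have L\<psi>0: "real_sub_laplacian \<psi> x = 0" if "vert_sq w x > 1" for x
    unfolding real_sub_laplacian_def
    by (intro sum.neutral ballI vf_apply_locally_zero[OF oB]) (use that \<psi>0 in auto)
  \<comment> \<open>\<open>T c\<close> is the substitution and \<open>P c\<close> its composition with the dilation. The latter has a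
      limit as \<open>c\<close> tends to zero although \<open>T c\<close> has none.\<close>
  define P :: "real \<Rightarrow> real^'n \<Rightarrow> real^'n" where
    "P c y = (\<chi> i. (if w i = 1 then c else 1) * y $ i)" for c y
  define T :: "real \<Rightarrow> real^'n \<Rightarrow> real^'n" where
    "T c y = (\<chi> i. (if w i = 1 then 1 else inverse (c ^ w i)) * y $ i)" for c y
  have T_nth: "T c y $ k = y $ k" if "k \<in> first_stratum w" for c y k
    using that by (simp add: T_def)
  have qT: "horiz_sq w (T c y) = horiz_sq w y" for c y
    unfolding T_def by (rule horiz_sq_scale) simp
  have \<phi>T: "\<phi> (T c y) = \<phi> y" for c y
    by (simp add: \<phi>_def radial_def qT)
  have X\<phi>T: "vf_apply (X k) \<phi> (T c y) = vf_apply (X k) \<phi> y" if "k \<in> first_stratum w" for k c y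
  proof -
    have "vf_apply (X k) \<phi> x = 2 * x $ k * radial w (a + 1) (\<lambda>t. h' t - a * h t) x" for x
      unfolding \<phi>_def by (rule X_radial[OF that h'(1) h0])
    then show ?thesis by (simp add: radial_def qT T_nth[OF that])
  qed
  have L\<phi>T: "real_sub_laplacian \<phi> (T c y) = real_sub_laplacian \<phi> y" for c y
    using real_sub_laplacian_radial[OF h'(1) h''(1) h(1) h'(2) h0, of a] by (simp add: \<phi>_def radial_def qT)
  have vP: "vert_sq w (P c y) = vert_sq w y" for c y
    unfolding P_def by (rule vert_sq_scale) simp
  have \<psi>P: "\<psi> (P c y) = \<psi> y" for c y
    by (simp add: \<psi>_def cutoff_def vP)
  have dT: "dilation w c (T c y) = P c y" if "c > 0" for c y
    using that by (simp add: dilation_def T_def P_def vec_eq_iff)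
  define f where "f c x = \<phi> x * \<psi> (dilation w c x)" for c x
  have \<psi>dC: "Ck_on m UNIV (\<lambda>x. \<psi> (dilation w c x))" for m c
    by (rule Ck_on_comp_linear[OF bounded_linear_dilation \<psi>C])
  have fC: "Ck_on m UNIV (f c)" for m c
    unfolding f_def by (intro Ck_on_mult open_UNIV \<phi>C \<psi>dC)
  define H where "H c y = (real_sub_laplacian \<phi> y * \<psi> y
      + 2 * c * (\<Sum>k\<in>first_stratum w. vf_apply (X k) \<phi> y * vf_apply (X k) \<psi> (P c y))
      + c\<^sup>2 * (\<phi> y * real_sub_laplacian \<psi> (P c y)))\<^sup>2 * horiz_sq w y powr (- \<delta>)" for c y
  define G where "G y = (\<phi> y * \<psi> y)\<^sup>2 * horiz_sq w y powr (- (\<delta> + 2))" for y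
  have step: "B\<^sup>2 * (\<integral>y. G y \<partial>lborel) \<le> (\<integral>y. H c y \<partial>lborel)" if c: "c > 0" for c
  proof -
    have lap: "real_sub_laplacian (f c) (T c y) = real_sub_laplacian \<phi> y * \<psi> y
      + 2 * c * (\<Sum>k\<in>first_stratum w. vf_apply (X k) \<phi> y * vf_apply (X k) \<psi> (P c y))
      + c\<^sup>2 * (\<phi> y * real_sub_laplacian \<psi> (P c y))" for y
    proof -
      have d\<psi>: "\<psi> differentiable (at x)" for x using \<psi>C[of 1] by simp
      have "(\<Sum>k\<in>first_stratum w. vf_apply (X k) \<phi> (T c y) * vf_apply (X k) (\<lambda>x. \<psi> (dilation w c x)) (T c y))
        = (\<Sum>k\<in>first_stratum w. c * (vf_apply (X k) \<phi> y * vf_apply (X k) \<psi> (P c y)))"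
        by (intro sum.cong) (auto simp: X_dilation[OF _ c d\<psi>] X\<phi>T dT[OF c])
      then show ?thesis
        unfolding f_def real_sub_laplacian_mult[OF \<phi>C \<psi>dC] real_sub_laplacian_dilation[OF c \<psi>C]
        by (simp add: dT[OF c] \<phi>T L\<phi>T \<psi>P sum_distrib_left[symmetric])
    qed
    have fT: "f c (T c y) = \<phi> y * \<psi> y" for y
      by (simp add: f_def \<phi>T dT[OF c] \<psi>P)
    have test: "(\<lambda>x. of_real (f c x)) \<in> test_functions {x. horizontal_norm w x \<noteq> 0}"
    proof -
      have contT: "continuous_on K (T c)"
        unfolding T_def by (intro continuous_intros)
      then have TK: "compact (T c ` K)"
        using K by (rule compact_continuous_image)
      have "x \<in> T c ` K" if "f c x \<noteq> 0" for x
      proof -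
        \<comment> \<open>The preimage of \<open>x\<close> under \<open>T c\<close>.\<close>
        define z :: "real^'n" where "z = (\<chi> i. (if w i = 1 then 1 else c ^ w i) * x $ i)"
        have z: "T c z = x" using c by (simp add: T_def z_def vec_eq_iff)
        then have "\<phi> z \<noteq> 0" "\<psi> z \<noteq> 0" using that fT[of z] by auto
        then have "z \<in> A" "\<not> vert_sq w z > 1" using \<phi>0[of z] \<psi>0[of z] by auto
        then have "z \<in> K" by (simp add: K_def A_def not_less)
        then show ?thesis using z by blast
      qed
      then have sub: "closure {x. complex_of_real (f c x) \<noteq> 0} \<subseteq> T c ` K"
        using TK by (intro closure_minimal compact_imp_closed) auto
      moreover have "T c ` K \<subseteq> {x. horizontal_norm w x \<noteq> 0}"
        by (auto simp: K_def horizontal_norm_nonzero_iff qT)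
      moreover have "compact (closure {x. complex_of_real (f c x) \<noteq> 0})"
        using compact_Int_closed[OF TK closed_closure] sub by (metis inf.absorb2)
      moreover have "Ck_on m UNIV (\<lambda>x. complex_of_real (f c x))" for m
        by (rule Ck_on_linear_comp[OF open_UNIV bounded_linear_of_real fC])
      ultimately show ?thesis
        unfolding test_functions_def smooth_on_def by blast
    qed
    define G1 where "G1 x = (f c x)\<^sup>2 * horiz_sq w x powr (- (\<delta> + 2))" for x
    define H1 where "H1 x = (real_sub_laplacian (f c) x)\<^sup>2 * horiz_sq w x powr (- \<delta>)" for x
    have nonneg: "0 \<le> (\<integral>x. G1 x \<partial>lborel)" "0 \<le> (\<integral>x. H1 x \<partial>lborel)"
      unfolding G1_def H1_def by simp_all
    have "B * sqrt (\<integral>x. G1 x \<partial>lborel) \<le> sqrt (\<integral>x. H1 x \<partial>lborel)"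
      using ineq[OF test]
      unfolding L2_norm_weighted sub_laplacian_of_real[OF fC] G1_def H1_def norm_of_real power2_abs .
    then have "(B * sqrt (\<integral>x. G1 x \<partial>lborel))\<^sup>2 \<le> (sqrt (\<integral>x. H1 x \<partial>lborel))\<^sup>2"
      using B nonneg by (intro power_mono) auto
    then have ineq1: "B\<^sup>2 * (\<integral>x. G1 x \<partial>lborel) \<le> (\<integral>x. H1 x \<partial>lborel)"
      using nonneg by (simp add: power_mult_distrib)
    define J where "J = (\<Prod>i\<in>UNIV. \<bar>if w i = 1 then 1 else inverse (c ^ w i)\<bar>)"
    have J: "J > 0" unfolding J_def using c by (intro prod_pos) auto
    have m: "f c \<in> borel_measurable borel" "real_sub_laplacian (f c) \<in> borel_measurable borel" "horiz_sq w \<in> borel_measurable borel"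
      using Ck_on_imp_continuous_on[OF fC[of 0]] Ck_on_imp_continuous_on[OF Ck_on_real_sub_laplacian[OF fC, of 0]]
        continuous_on_horiz_sq[of UNIV w] by (simp_all add: borel_measurable_continuous_onI)
    have "G1 \<in> borel_measurable borel" "H1 \<in> borel_measurable borel"
      unfolding G1_def H1_def using m by measurable
    then have "(\<integral>x. G1 x \<partial>lborel) = J * (\<integral>y. G1 (T c y) \<partial>lborel)"
      "(\<integral>x. H1 x \<partial>lborel) = J * (\<integral>y. H1 (T c y) \<partial>lborel)"
      unfolding J_def T_def using c by (intro integral_diagonal_scaling; simp)+
    moreover have "G1 (T c y) = G y" "H1 (T c y) = H c y" for y
      by (simp_all add: G1_def H1_def G_def H_def fT lap qT)
    ultimately have "J * (B\<^sup>2 * (\<integral>y. G y \<partial>lborel)) \<le> J * (\<integral>y. H c y \<partial>lborel)"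
      using ineq1 by (simp add: mult.left_commute)
    then show ?thesis using J by simp
  qed
  have "(\<lambda>n. \<integral>y. H (1 / real (Suc n)) y \<partial>lborel) \<longlonglongrightarrow> (\<integral>y. H 0 y \<partial>lborel)"
  proof (rule tendsto_integral_parameter)
    show "compact K" by (rule K)
    show "H c y = 0" if "y \<notin> K" for c y
    proof (cases "y \<in> A")
      case False
      then show ?thesis using \<phi>0 X\<phi>0 L\<phi>0 by (simp add: H_def)
    next
      case True
      then have "vert_sq w y > 1" using that by (auto simp: K_def A_def)
      then show ?thesis using \<psi>0 X\<psi>0 L\<psi>0 by (simp add: H_def vP)
    qed
    have P: "continuous_on ({0..1} \<times> UNIV) (\<lambda>z. P (fst z) (snd z))"
      unfolding P_def
      apply (rule continuous_on_vec_lambda)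
      subgoal for i by (cases "w i = 1") (simp_all, (intro continuous_intros)+)
      done
    have c1: "continuous_on ({0..1} \<times> UNIV) (\<lambda>z. u (snd z))" if "Ck_on 0 UNIV u" for u :: "real^'n \<Rightarrow> real"
      by (rule continuous_on_compose2[of UNIV u]) (use that in \<open>auto intro!: continuous_intros\<close>)
    have c2: "continuous_on ({0..1} \<times> UNIV) (\<lambda>z. u (P (fst z) (snd z)))" if "Ck_on 0 UNIV u" for u :: "real^'n \<Rightarrow> real"
      by (rule continuous_on_compose2[of UNIV u, OF _ P]) (use that in auto)
    have "continuous_on ({0..1} \<times> UNIV) (\<lambda>z. H (fst z) (snd z))"
      unfolding H_def
    proof (intro continuous_on_mult continuous_on_add continuous_on_power continuous_on_sum
        continuous_on_const continuous_on_fst continuous_on_id)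
      show "continuous_on ({0..1} \<times> UNIV) (\<lambda>z. real_sub_laplacian \<phi> (snd z))"
        "continuous_on ({0..1} \<times> UNIV) (\<lambda>z. \<phi> (snd z))"
        "continuous_on ({0..1} \<times> UNIV) (\<lambda>z. \<psi> (snd z))"
        by (intro c1 Ck_on_real_sub_laplacian \<phi>C \<psi>C)+
      show "continuous_on ({0..1} \<times> UNIV) (\<lambda>z. real_sub_laplacian \<psi> (P (fst z) (snd z)))"
        by (intro c2 Ck_on_real_sub_laplacian \<psi>C)
      show "continuous_on ({0..1} \<times> UNIV) (\<lambda>z. vf_apply (X k) \<phi> (snd z))"
        "continuous_on ({0..1} \<times> UNIV) (\<lambda>z. vf_apply (X k) \<psi> (P (fst z) (snd z)))"
        if "k \<in> first_stratum w" for k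
        by (intro c1 c2 Ck_on_X_apply that open_UNIV \<phi>C \<psi>C)+
      show "continuous_on ({0..1} \<times> UNIV) (\<lambda>z. horiz_sq w (snd z) powr - \<delta>)"
      proof (rule continuous_on_powr')
        show "continuous_on ({0..1} \<times> UNIV) (\<lambda>z. horiz_sq w (snd z))"
          by (intro c1 Ck_on_horiz_sq open_UNIV)
      qed (use \<delta> horiz_sq_nonneg in auto)
    qed
    then show "continuous_on ({0..1} \<times> UNIV) (\<lambda>(c, y). H c y)"
      by (simp add: case_prod_unfold)
  qed
  then have "B\<^sup>2 * (\<integral>y. G y \<partial>lborel) \<le> (\<integral>y. H 0 y \<partial>lborel)"
    by (rule LIMSEQ_le_const) (auto intro!: exI[of _ 0] step simp del: of_nat_Suc)
  moreover have "H 0 y = (real_sub_laplacian \<phi> y * \<psi> y)\<^sup>2 * horiz_sq w y powr (- \<delta>)" for y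
    by (simp add: H_def)
  ultimately show ?thesis by (simp add: G_def \<phi>_def \<psi>_def)
qed

end

section \<open>Translation invariance on the logarithmic scale\<close>

context stratified_group
begin

text \<open>The common weight of the two integrals, restricted to a unit interval in the variable
  \<open>ln |x'|\<^sup>2\<close>. At \<open>x' = 0\<close>, where \<open>ln 0 = 0\<close> lies in the interval for \<open>j = 0\<close>, the power is zero.\<close>

definition log_mass :: "nat \<Rightarrow> real^'n \<Rightarrow> real" where
  "log_mass j x = (cutoff w x)\<^sup>2 * horiz_sq w x powr (- (real (card (first_stratum w)) / 2))
     * indicator {real j..<real j + 1} (ln (horiz_sq w x))"

lemma log_mass_nonneg: "log_mass j x \<ge> 0"
  by (simp add: log_mass_def)

lemma log_mass_measurable: "log_mass j \<in> borel_measurable borel"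
proof -
  have "cutoff w \<in> borel_measurable borel" "horiz_sq w \<in> borel_measurable borel"
    using Ck_on_imp_continuous_on[OF Ck_on_cutoff[of 0 w]] continuous_on_horiz_sq[of UNIV w]
    by (simp_all add: borel_measurable_continuous_onI)
  then show ?thesis unfolding log_mass_def by measurable
qed

lemma integrable_log_mass: "integrable lborel (log_mass j)"
proof -
  define K where "K = {x. 1 \<le> horiz_sq w x \<and> horiz_sq w x \<le> exp (real j + 1) \<and> vert_sq w x \<le> 1}"
  define g where "g x = (cutoff w x)\<^sup>2 * horiz_sq w x powr (- (real (card (first_stratum w)) / 2))" for x
  have "continuous_on K (\<lambda>x. horiz_sq w x powr (- (real (card (first_stratum w)) / 2)))"
    using Ck_on_imp_continuous_on[OF Ck_on_horiz_sq_powr[of 0 w]]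
    by (rule continuous_on_subset) (auto simp: K_def)
  moreover have "continuous_on K (cutoff w)"
    using Ck_on_imp_continuous_on[OF Ck_on_cutoff[of 0 w]] by (rule continuous_on_subset) simp
  ultimately have "continuous_on K g"
    unfolding g_def by (intro continuous_on_mult continuous_on_power)
  moreover have "compact K" unfolding K_def by (rule compact_annulus)
  ultimately have int: "integrable lborel (\<lambda>x. indicator K x *\<^sub>R g x)"
    by (intro borel_integrable_compact)
  have "log_mass j x \<le> indicator K x *\<^sub>R g x" for x
  proof (cases "log_mass j x = 0")
    case True
    then show ?thesis by (simp add: g_def)
  next
    case False
    then have nz: "cutoff w x \<noteq> 0" "horiz_sq w x \<noteq> 0" "real j \<le> ln (horiz_sq w x)" "ln (horiz_sq w x) < real j + 1"
      by (auto simp: log_mass_def indicator_def split: if_splits)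
    have q: "horiz_sq w x > 0" using nz(2) horiz_sq_nonneg[of w x] by simp
    have "exp 0 \<le> exp (ln (horiz_sq w x))" "exp (ln (horiz_sq w x)) \<le> exp (real j + 1)"
      unfolding exp_le_cancel_iff using nz(3,4) by linarith+
    then have "1 \<le> horiz_sq w x" "horiz_sq w x \<le> exp (real j + 1)" using q by simp_all
    moreover have "vert_sq w x \<le> 1" using nz(1) cutoff_eq_0[of w x] by (cases "vert_sq w x \<le> 1") auto
    ultimately have "x \<in> K" by (simp add: K_def)
    then show ?thesis using nz(3,4) by (simp add: log_mass_def g_def)
  qed
  then show ?thesis
    using log_mass_measurable log_mass_nonneg
    by (intro Bochner_Integration.integrable_bound[OF int])
       (auto intro!: AE_I2 order_trans[OF _ abs_ge_self])
qed

text \<open>Multiplying \<open>x'\<close> by \<open>exp (j/2)\<close> translates \<open>ln |x'|\<^sup>2\<close> by \<open>j\<close>, and its Jacobian \<open>exp (j N / 2)\<close>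
  cancels against the factor produced by the weight \<open>|x'| powr (-N)\<close>.\<close>

lemma integral_log_mass: "(\<integral>x. log_mass j x \<partial>lborel) = (\<integral>x. log_mass 0 x \<partial>lborel)"
proof -
  define N where "N = real (card (first_stratum w))"
  define c where "c i = (if w i = 1 then exp (real j / 2) else 1)" for i
  define T :: "real^'n \<Rightarrow> real^'n" where "T x = (\<chi> i. c i * x $ i)" for x
  have "(\<Prod>i\<in>UNIV. \<bar>c i\<bar>) = (\<Prod>i\<in>UNIV. c i)"
    by (intro prod.cong) (auto simp: c_def)
  also have "\<dots> = exp (real j / 2) ^ card (first_stratum w)"
    unfolding c_def by (subst prod.inter_filter[symmetric]) auto
  also have "\<dots> = exp (real j * (N / 2))"
    by (simp add: N_def exp_of_nat_mult[symmetric])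
  finally have J: "(\<Prod>i\<in>UNIV. \<bar>c i\<bar>) = exp (real j * (N / 2))" .
  have lm: "log_mass i y = (cutoff w y)\<^sup>2 * horiz_sq w y powr (- (N / 2))
      * indicator {real i..<real i + 1} (ln (horiz_sq w y))" for i y
    by (simp only: log_mass_def N_def)
  have q: "horiz_sq w (T x) = exp (real j) * horiz_sq w x" for x
  proof -
    have "(exp (real j / 2))\<^sup>2 = exp (real j)" by (simp add: exp_double[symmetric])
    then have "horiz_sq w (T x) = (\<Sum>i\<in>first_stratum w. exp (real j) * (x $ i)\<^sup>2)"
      unfolding horiz_sq_def by (intro sum.cong) (auto simp: T_def c_def power_mult_distrib)
    then show ?thesis by (simp add: horiz_sq_def sum_distrib_left)
  qed
  have v: "vert_sq w (T x) = vert_sq w x" for x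
    unfolding T_def by (rule vert_sq_scale) (simp add: c_def)
  have "exp (real j * (N / 2)) * log_mass j (T x) = log_mass 0 x" for x
  proof (cases "horiz_sq w x = 0")
    case True
    then show ?thesis by (simp add: log_mass_def q)
  next
    case False
    then have qx: "horiz_sq w x > 0" using horiz_sq_nonneg[of w x] by simp
    have "ln (horiz_sq w (T x)) = real j + ln (horiz_sq w x)"
      using qx by (simp add: q ln_mult)
    moreover have "exp (real j * (N / 2)) * horiz_sq w (T x) powr (- (N / 2)) = horiz_sq w x powr (- (N / 2))"
      using qx by (simp add: q powr_mult powr_def[of "exp _"] exp_add[symmetric] exp_minus_inverse flip: mult.assoc)
    ultimately show ?thesis
      by (simp only: lm cutoff_def v) (auto simp: indicator_def mult.left_commute)
  qed
  moreover have "(\<integral>x. log_mass j x \<partial>lborel) = exp (real j * (N / 2)) * (\<integral>x. log_mass j (T x) \<partial>lborel)"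
    unfolding J[symmetric] T_def by (rule integral_diagonal_scaling) (auto simp: c_def log_mass_measurable)
  ultimately show ?thesis by (simp flip: integral_mult_right_zero)
qed

text \<open>The integrand is positive on a nonempty open set.\<close>

lemma integral_log_mass_pos:
  assumes "first_stratum w \<noteq> {}"
  shows "(\<integral>x. log_mass 0 x \<partial>lborel) > 0"
proof (rule ccontr)
  assume "\<not> (\<integral>x. log_mass 0 x \<partial>lborel) > 0"
  moreover have "(\<integral>x. log_mass 0 x \<partial>lborel) \<ge> 0"
    by (intro integral_nonneg_AE AE_I2 log_mass_nonneg)
  ultimately have "(\<integral>x. log_mass 0 x \<partial>lborel) = 0" by simp
  then have AE: "AE x in lborel. log_mass 0 x = 0"
    using integral_nonneg_eq_0_iff_AE[OF integrable_log_mass] log_mass_nonneg by auto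
  define V where "V = {x::real^'n. 1 < horiz_sq w x \<and> horiz_sq w x < exp 1 \<and> vert_sq w x < 1}"
  have "open V"
    unfolding V_def by (intro open_Collect_conj open_Collect_less continuous_on_horiz_sq continuous_on_vert_sq continuous_intros)
  have "AE x in lborel. x \<notin> V"
    using AE
  proof (rule AE_mp, intro AE_I2 impI)
    fix x assume 0: "log_mass 0 x = 0"
    show "x \<notin> V"
    proof
      assume "x \<in> V"
      then have x: "1 < horiz_sq w x" "horiz_sq w x < exp 1" "vert_sq w x < 1" by (auto simp: V_def)
      then have "ln (horiz_sq w x) < 1" using ln_less_cancel_iff[of "horiz_sq w x" "exp 1"] by simp
      moreover have "0 \<le> ln (horiz_sq w x)" using x by simp
      moreover have "cutoff w x > 0" using x by (simp add: cutoff_def flat_def)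
      ultimately have "log_mass 0 x > 0" using x by (simp add: log_mass_def)
      then show False using 0 by simp
    qed
  qed
  then have "V \<in> null_sets lborel"
    using \<open>open V\<close> by (subst (asm) AE_iff_null_sets[symmetric]) auto
  then have "negligible V"
    using negligible_iff_null_sets null_sets_completionI by blast
  moreover obtain k where k: "k \<in> first_stratum w" using assms by blast
  have "axis k (sqrt 2) \<in> V"
  proof -
    have "horiz_sq w (axis k (sqrt 2)) = (\<Sum>i\<in>first_stratum w. if i = k then 2 else 0)"
      unfolding horiz_sq_def by (intro sum.cong) (auto simp: axis_def)
    then have "horiz_sq w (axis k (sqrt 2)) = 2" using k by simp
    moreover have "vert_sq w (axis k (sqrt 2)) = 0"
      unfolding vert_sq_def using k by (intro sum.neutral) (auto simp: axis_def)
    moreover have "exp (1::real) > 2" using exp_ge_add_one_self_aux[of "1::real"] exp_lower_Taylor_quadratic[of "1::real"] by simp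
    ultimately show ?thesis by (simp add: V_def)
  qed
  then have "V \<noteq> {}" by blast
  ultimately show False using open_not_negligible[OF \<open>open V\<close>] by blast
qed

end

section \<open>Sharpness\<close>

text \<open>Rises from 0 to 1 on \<open>[0, 1]\<close> and falls back on \<open>[M + 1, M + 2]\<close>. As a difference of two translates
  of one function, its flanks have the same shape for all \<open>M\<close>.\<close>

definition plateau :: "nat \<Rightarrow> real \<Rightarrow> real" where
  "plateau M t = smooth_step t - smooth_step (t - (real M + 1))"

text \<open>Four unit intervals cover the closed flanks; the right endpoint of each flank lies in the
  interval after it.\<close>

definition plateau_weight :: "real \<Rightarrow> real \<Rightarrow> nat \<Rightarrow> nat \<Rightarrow> real" where
  "plateau_weight C B M j
    = C\<^sup>2 + B * (of_bool (j = 0) + of_bool (j = 1) + of_bool (j = M + 1) + of_bool (j = M + 2))"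

text \<open>Off the flanks the profile is locally constant, so the operator returns \<open>-C\<close> or 0. On the flanks
  it is bounded independently of \<open>M\<close>.\<close>

lemma plateau_laplacian_bound:
  fixes b C :: real
  obtains B where "B \<ge> 0"
    and "\<And>M. \<exists>h' h''. (\<forall>t. (plateau M has_real_derivative h' t) (at t)) \<and> (\<forall>t. (h' has_real_derivative h'' t) (at t))
      \<and> (\<forall>m. Ck_on m UNIV h')
      \<and> (\<forall>t. (4 * h'' t + b * h' t - C * plateau M t)\<^sup>2
            \<le> (\<Sum>j<M+3. plateau_weight C B M j
                * indicator {real j..<real j + 1} t))"
proof -
  obtain s1 where s1: "\<And>t. (smooth_step has_real_derivative s1 t) (at t)" "\<And>m. Ck_on m UNIV s1"
    using Ck_on_real_derivative[OF Ck_on_smooth_step] by blast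
  obtain s2 where s2: "\<And>t. (s1 has_real_derivative s2 t) (at t)" "\<And>m. Ck_on m UNIV s2"
    using Ck_on_real_derivative[OF s1(2)] by blast
  have s1_left: "s1 t = 0" if "t < 0" for t
    by (rule derivative_locally_constant[OF s1(1), of "{..<0}"]) (use that smooth_step_eq_0 in auto)
  have s1_right: "s1 t = 0" if "t > 1" for t
    by (rule derivative_locally_constant[OF s1(1), of "{1<..}" _ 1]) (use that smooth_step_eq_1 in auto)
  have s2_left: "s2 t = 0" if "t < 0" for t
    by (rule derivative_locally_constant[OF s2(1), of "{..<0}"]) (use that s1_left in auto)
  have s2_right: "s2 t = 0" if "t > 1" for t
    by (rule derivative_locally_constant[OF s2(1), of "{1<..}"]) (use that s1_right in auto)
  \<comment> \<open>The operator applied to a single step; the plateau is a difference of two translates.\<close>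
  define e where "e t = 4 * s2 t + b * s1 t - C * smooth_step t" for t
  have e_left: "e t = 0" if "t < 0" for t
    using that s1_left s2_left smooth_step_eq_0 by (simp add: e_def)
  have e_right: "e t = - C" if "t > 1" for t
    using that s1_right s2_right smooth_step_eq_1 by (simp add: e_def)
  have "Ck_on 0 UNIV e"
    unfolding e_def by (intro Ck_on_diff Ck_on_add Ck_on_mult Ck_on_const s1 s2 Ck_on_smooth_step open_UNIV)
  then have "continuous_on {0..1} e" by (auto intro: continuous_on_subset)
  then have "bounded (e ` {0..1})"
    by (intro compact_imp_bounded compact_continuous_image) auto
  then obtain b0 where "\<forall>y\<in>e ` {0..1}. norm y \<le> b0" unfolding bounded_iff by blast
  then have b0: "\<bar>e t\<bar> \<le> b0" if "t \<in> {0..1}" for t using that by simp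
  define b1 where "b1 = max b0 \<bar>C\<bar>"
  have e_bound: "\<bar>e t\<bar> \<le> b1" for t
  proof -
    consider "t < 0" | "t \<in> {0..1}" | "t > 1" by force
    then show ?thesis by cases (use b0[of t] e_left e_right in \<open>auto simp: b1_def\<close>)
  qed
  define B where "B = (2 * b1)\<^sup>2"
  have "B \<ge> 0" by (simp add: B_def)
  moreover have "\<exists>h' h''. (\<forall>t. (plateau M has_real_derivative h' t) (at t)) \<and> (\<forall>t. (h' has_real_derivative h'' t) (at t))
      \<and> (\<forall>m. Ck_on m UNIV h')
      \<and> (\<forall>t. (4 * h'' t + b * h' t - C * plateau M t)\<^sup>2
            \<le> (\<Sum>j<M+3. plateau_weight C B M j
                * indicator {real j..<real j + 1} t))" for M
  proof (rule exI[of _ "\<lambda>t. s1 t - s1 (t - (real M + 1))"],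
      rule exI[of _ "\<lambda>t. s2 t - s2 (t - (real M + 1))"], intro conjI allI)
    have shift: "((\<lambda>t. g (t - s)) has_real_derivative g' (t - s)) (at t)"
      if "\<And>t. (g has_real_derivative g' t) (at t)" for g g' s t
    proof -
      have "((\<lambda>t. t - s) has_real_derivative 1) (at t)"
        by (auto intro!: derivative_eq_intros)
      from DERIV_chain2[where f = g and g = "\<lambda>t. t - s" and x = t, OF that this] show ?thesis by simp
    qed
    show "(plateau M has_real_derivative s1 t - s1 (t - (real M + 1))) (at t)" for t
      unfolding plateau_def[abs_def] by (intro DERIV_diff s1 shift)
    show "((\<lambda>t. s1 t - s1 (t - (real M + 1))) has_real_derivative s2 t - s2 (t - (real M + 1))) (at t)" for t
      by (intro DERIV_diff s2 shift)
    show "Ck_on m UNIV (\<lambda>t. s1 t - s1 (t - (real M + 1)))" for m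
      by (intro Ck_on_diff open_UNIV s1 Ck_on_shift)
    fix t :: real
    define E where "E = 4 * (s2 t - s2 (t - (real M + 1))) + b * (s1 t - s1 (t - (real M + 1))) - C * plateau M t"
    define coef where "coef j = plateau_weight C B M j" for j
    have E: "E = e t - e (t - (real M + 1))"
      by (simp add: E_def e_def plateau_def algebra_simps)
    have coef0: "coef j \<ge> 0" for j using \<open>B \<ge> 0\<close> by (simp add: coef_def plateau_weight_def)
    have "E\<^sup>2 \<le> (\<Sum>j<M+3. coef j * indicator {real j..<real j + 1} t)"
    proof (cases "t < 0 \<or> t > real M + 2")
      case True
      then have "E = 0" using E e_left e_right by auto
      then show ?thesis using coef0 by (simp add: sum_nonneg)
    next
      case False
      define j where "j = nat \<lfloor>t\<rfloor>"
      have j: "real j \<le> t" "t < real j + 1" "j < M + 3"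
        using False unfolding j_def by linarith+
      have "E\<^sup>2 \<le> coef j"
      proof (cases "j = 0 \<or> j = 1 \<or> j = M + 1 \<or> j = M + 2")
        case True
        have "\<bar>E\<bar> \<le> 2 * b1" using e_bound[of t] e_bound[of "t - (real M + 1)"] unfolding E by linarith
        then have "E\<^sup>2 \<le> B" unfolding B_def by (rule abs_le_square_iff[THEN iffD1, OF order_trans[OF _ abs_ge_self]])
        also have "B = B * 1" by simp
        also have "B * 1 \<le> B * (of_bool (j = 0) + of_bool (j = 1) + of_bool (j = M + 1) + of_bool (j = M + 2))"
          using True \<open>B \<ge> 0\<close> by (intro mult_left_mono) auto
        also have "\<dots> \<le> coef j" by (simp add: coef_def plateau_weight_def)
        finally show ?thesis .
      next
        case False
        then have "j \<ge> 2" "j \<le> M" using j(3) by auto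
        then have "t > 1" "t - (real M + 1) < 0" using j by linarith+
        then have "E = - C" using E e_left e_right by simp
        then show ?thesis using \<open>B \<ge> 0\<close> by (simp add: coef_def plateau_weight_def)
      qed
      also have "coef j = coef j * indicator {real j..<real j + 1} t" using j by simp
      also have "\<dots> \<le> (\<Sum>j<M+3. coef j * indicator {real j..<real j + 1} t)"
        by (rule member_le_sum) (use j coef0 in auto)
      finally show ?thesis .
    qed
    then show "(4 * (s2 t - s2 (t - (real M + 1))) + b * (s1 t - s1 (t - (real M + 1))) - C * plateau M t)\<^sup>2
      \<le> (\<Sum>j<M+3. plateau_weight C B M j
          * indicator {real j..<real j + 1} t)"
      by (simp add: E_def coef_def)
  qed
  ultimately show thesis by (rule that)
qed

lemma plateau_lower_bound:
  "(\<Sum>j\<in>{1..M}. indicator {real j..<real j + 1} t) \<le> (plateau M t)\<^sup>2"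
proof (cases "1 \<le> t \<and> t < real M + 1")
  case True
  define i where "i = nat \<lfloor>t\<rfloor>"
  have "(\<Sum>j\<in>{1..M}. indicator {real j..<real j + 1} t) \<le> (\<Sum>j\<in>{1..M}. if j = i then 1 else (0::real))"
  proof (rule sum_mono)
    fix j assume "j \<in> {1..M}"
    show "indicator {real j..<real j + 1} t \<le> (if j = i then 1 else (0::real))"
    proof (cases "real j \<le> t \<and> t < real j + 1")
      case True
      then have "j = i" unfolding i_def by linarith
      then show ?thesis by (simp add: indicator_def)
    qed (auto simp: indicator_def)
  qed
  also have "\<dots> \<le> 1" by simp
  also have "1 = (plateau M t)\<^sup>2" using True by (simp add: plateau_def smooth_step_eq_0 smooth_step_eq_1)
  finally show ?thesis .
next
  case False
  have "(\<Sum>j\<in>{1..M}. indicator {real j..<real j + 1} t) = (0::real)"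
  proof (intro sum.neutral ballI)
    fix j assume j: "j \<in> {1..M}"
    then have "1 \<le> real j" "real j \<le> real M" by auto
    then show "indicator {real j..<real j + 1} t = (0::real)" using False by (auto simp: indicator_def)
  qed
  then show ?thesis by simp
qed

context stratified_group
begin

text \<open>If the inequality holds with \<open>B\<close>, then for every \<open>M\<close> the plateau functions give
  \<open>B\<^sup>2 M m \<le> (C\<^sup>2 (M + 3) + 4 E) m\<close>, where \<open>C\<close> is the constant of the inequality, \<open>m > 0\<close> the
  mass of a unit interval, and \<open>E\<close> a bound for the flanks. Divide by \<open>m\<close> and compare the growth in \<open>M\<close>.\<close>

lemma rellich_constant_le:
  fixes \<delta> B :: real
  defines "N \<equiv> real (card (first_stratum w))"
  assumes ineq: "\<And>f. f \<in> test_functions {x. horizontal_norm w x \<noteq> 0} \<Longrightarrow>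
      B * L2_norm (\<lambda>x. f x / of_real (horizontal_norm w x powr (\<delta> + 2)))
      \<le> L2_norm (\<lambda>x. sub_laplacian w X f x / of_real (horizontal_norm w x powr \<delta>))"
    and B: "B \<ge> 0" and \<delta>: "\<delta> < 0" and N: "first_stratum w \<noteq> {}"
  shows "B\<^sup>2 \<le> ((N - 2 * \<delta> - 4) * (N + 2 * \<delta>) / 4)\<^sup>2"
proof -
  \<comment> \<open>With this exponent both integrands carry the weight \<open>|x'| powr (-N)\<close>.\<close>
  define a where "a = (N - 2 * \<delta> - 4) / 4"
  define C where "C = a * (N + 2 * \<delta>)"
  define b where "b = 2 * N - 8 * a - 4"
  have C': "a * (2 * N - 4 * a - 4) = C" by (simp add: C_def a_def field_simps)
  define m where "m = (\<integral>x. log_mass 0 x \<partial>lborel)"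
  have m: "m > 0" unfolding m_def by (rule integral_log_mass_pos[OF N])
  obtain E where E: "E \<ge> 0"
    and ex: "\<And>M. \<exists>h' h''. (\<forall>t. (plateau M has_real_derivative h' t) (at t)) \<and> (\<forall>t. (h' has_real_derivative h'' t) (at t))
      \<and> (\<forall>m. Ck_on m UNIV h')
      \<and> (\<forall>t. (4 * h'' t + b * h' t - C * plateau M t)\<^sup>2
            \<le> (\<Sum>j<M+3. plateau_weight C E M j
                * indicator {real j..<real j + 1} t))"
    using plateau_laplacian_bound[of b C] by blast
  have bound: "real M * (B\<^sup>2 - C\<^sup>2) \<le> 3 * C\<^sup>2 + 4 * E" for M :: nat
  proof -
    obtain h' h'' where h': "\<And>t. (plateau M has_real_derivative h' t) (at t)"
        "\<And>t. (h' has_real_derivative h'' t) (at t)" "\<And>m. Ck_on m UNIV h'"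
      and lap_bound: "\<And>t. (4 * h'' t + b * h' t - C * plateau M t)\<^sup>2
          \<le> (\<Sum>j<M+3. plateau_weight C E M j
                * indicator {real j..<real j + 1} t)"
      using ex[of M] by blast
    define coef where "coef j = plateau_weight C E M j" for j
    have h: "Ck_on k UNIV (plateau M)" for k
      unfolding plateau_def[abs_def] by (intro Ck_on_diff open_UNIV Ck_on_smooth_step Ck_on_shift)
    have h0: "plateau M t = 0" if "t \<notin> {0..real M + 2}" for t
      using that by (auto simp: plateau_def smooth_step_eq_0 smooth_step_eq_1 not_le)
    have h0': "plateau M t = 0" if "t < 0" for t using h0 that by simp
    define \<rho> where "\<rho> x = (cutoff w x)\<^sup>2 * horiz_sq w x powr (- (N / 2))" for x
    have \<rho>0: "\<rho> x \<ge> 0" for x by (simp add: \<rho>_def)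
    have lm: "log_mass j x = \<rho> x * indicator {real j..<real j + 1} (ln (horiz_sq w x))" for j x
      by (simp only: log_mass_def \<rho>_def N_def)
    have weight: "(horiz_sq w x powr (- c))\<^sup>2 * horiz_sq w x powr d = horiz_sq w x powr (- (N / 2))"
      if "- 2 * c + d = - (N / 2)" for c d and x :: "real^'n"
    proof -
      have "(horiz_sq w x powr (- c))\<^sup>2 * horiz_sq w x powr d = horiz_sq w x powr (- c + - c + d)"
        by (simp only: power2_eq_square powr_add)
      also have "- c + - c + d = - (N / 2)" using that by simp
      finally show ?thesis .
    qed
    have \<phi>: "(radial w a (plateau M) x * cutoff w x)\<^sup>2 * horiz_sq w x powr (- (\<delta> + 2))
        = \<rho> x * (plateau M (ln (horiz_sq w x)))\<^sup>2" for x
    proof -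
      have "(horiz_sq w x powr (- a))\<^sup>2 * horiz_sq w x powr (- (\<delta> + 2)) = horiz_sq w x powr (- (N / 2))"
        by (rule weight) (simp add: a_def field_simps)
      from this[symmetric] show ?thesis
        unfolding radial_def \<rho>_def power_mult_distrib by (simp only: mult_ac)
    qed
    have L\<phi>: "(real_sub_laplacian (radial w a (plateau M)) x * cutoff w x)\<^sup>2 * horiz_sq w x powr (- \<delta>)
        = \<rho> x * (4 * h'' (ln (horiz_sq w x)) + b * h' (ln (horiz_sq w x)) - C * plateau M (ln (horiz_sq w x)))\<^sup>2" for x
    proof -
      have "real_sub_laplacian (radial w a (plateau M)) x
          = radial w (a + 1) (\<lambda>t. 4 * h'' t + b * h' t - C * plateau M t) x"
        using real_sub_laplacian_radial[OF h'(1,2) h h'(3) h0', of a x]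
        unfolding N_def[symmetric] b_def[symmetric] C' by simp
      moreover have "horiz_sq w x powr (- (N / 2)) = (horiz_sq w x powr (- (a + 1)))\<^sup>2 * horiz_sq w x powr (- \<delta>)"
        by (rule weight[symmetric]) (simp add: a_def field_simps)
      ultimately show ?thesis
        unfolding radial_def \<rho>_def by (simp only: power_mult_distrib mult_ac)
    qed
    have int: "integrable lborel (log_mass j)" for j by (rule integrable_log_mass)
    have int_eq: "(\<integral>x. log_mass j x \<partial>lborel) = m" for j
      unfolding m_def by (rule integral_log_mass)
    have "B\<^sup>2 * (real M * m) = B\<^sup>2 * (\<integral>x. (\<Sum>j\<in>{1..M}. log_mass j x) \<partial>lborel)"
      using int by (simp add: int_eq)
    also have "\<dots> \<le> B\<^sup>2 * (\<integral>x. (radial w a (plateau M) x * cutoff w x)\<^sup>2 * horiz_sq w x powr (- (\<delta> + 2)) \<partial>lborel)"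
    proof (intro mult_left_mono integral_mono)
      show "(\<Sum>j\<in>{1..M}. log_mass j x) \<le> (radial w a (plateau M) x * cutoff w x)\<^sup>2 * horiz_sq w x powr (- (\<delta> + 2))" for x
        unfolding \<phi> lm sum_distrib_left[symmetric]
        by (intro mult_left_mono \<rho>0 plateau_lower_bound)
      show "integrable lborel (\<lambda>x. (radial w a (plateau M) x * cutoff w x)\<^sup>2 * horiz_sq w x powr (- (\<delta> + 2)))"
      proof (rule integrable_compact_support[OF compact_annulus[of w "exp (real M + 2)"]])
        show "continuous_on {x. 1 \<le> horiz_sq w x \<and> horiz_sq w x \<le> exp (real M + 2) \<and> vert_sq w x \<le> 1}
          (\<lambda>x. (radial w a (plateau M) x * cutoff w x)\<^sup>2 * horiz_sq w x powr (- (\<delta> + 2)))"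
        proof (intro continuous_on_mult continuous_on_power)
          show "continuous_on {x. 1 \<le> horiz_sq w x \<and> horiz_sq w x \<le> exp (real M + 2) \<and> vert_sq w x \<le> 1} (\<lambda>x. horiz_sq w x powr (- (\<delta> + 2)))"
            using Ck_on_imp_continuous_on[OF Ck_on_horiz_sq_powr[of 0 w]] by (rule continuous_on_subset) auto
        qed (use Ck_on_imp_continuous_on[OF Ck_on_radial[OF h h0', of 0]] Ck_on_imp_continuous_on[OF Ck_on_cutoff[of 0]]
             in \<open>auto intro: continuous_on_subset\<close>)
        show "(radial w a (plateau M) x * cutoff w x)\<^sup>2 * horiz_sq w x powr (- (\<delta> + 2)) = 0"
          if out: "x \<notin> {x. 1 \<le> horiz_sq w x \<and> horiz_sq w x \<le> exp (real M + 2) \<and> vert_sq w x \<le> 1}" for x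
        proof -
          consider "vert_sq w x > 1" | "horiz_sq w x < 1" | "horiz_sq w x > exp (real M + 2)"
            using out by (force simp: not_le)
          then show ?thesis
          proof cases
            case 1
            then show ?thesis by (simp add: cutoff_eq_0)
          next
            case 2
            then show ?thesis by (simp add: radial_eq_0[OF h0'])
          next
            case 3
            then have "ln (exp (real M + 2)) < ln (horiz_sq w x)"
              using less_trans[OF exp_gt_zero 3] by (subst ln_less_cancel_iff) auto
            then show ?thesis by (simp add: radial_def h0)
          qed
        qed
      qed
    qed (use int in auto)
    also have "\<dots> \<le> (\<integral>x. (real_sub_laplacian (radial w a (plateau M)) x * cutoff w x)\<^sup>2 * horiz_sq w x powr (- \<delta>) \<partial>lborel)"
      by (rule rellich_two_scale_limit[OF ineq B \<delta> h h0])
    also have "\<dots> \<le> (\<integral>x. (\<Sum>j<M+3. coef j * log_mass j x) \<partial>lborel)"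
    proof (rule integral_mono')
      show "integrable lborel (\<lambda>x. \<Sum>j<M+3. coef j * log_mass j x)"
        by (intro Bochner_Integration.integrable_sum integrable_mult_right int)
      show "(real_sub_laplacian (radial w a (plateau M)) x * cutoff w x)\<^sup>2 * horiz_sq w x powr (- \<delta>) \<le> (\<Sum>j<M+3. coef j * log_mass j x)" for x
      proof -
        have "\<rho> x * (4 * h'' (ln (horiz_sq w x)) + b * h' (ln (horiz_sq w x)) - C * plateau M (ln (horiz_sq w x)))\<^sup>2
            \<le> \<rho> x * (\<Sum>j<M+3. coef j * indicator {real j..<real j + 1} (ln (horiz_sq w x)))"
          using lap_bound unfolding coef_def by (intro mult_left_mono \<rho>0)
        moreover have "(\<Sum>j<M+3. coef j * log_mass j x)
            = \<rho> x * (\<Sum>j<M+3. coef j * indicator {real j..<real j + 1} (ln (horiz_sq w x)))"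
          by (simp only: lm sum_distrib_left mult.left_commute)
        ultimately show ?thesis unfolding L\<phi> by (simp only:)
      qed
    qed (auto intro!: sum_nonneg simp: coef_def plateau_weight_def log_mass_nonneg E)
    also have "\<dots> = (\<Sum>j<M+3. coef j) * m"
      using int by (simp add: int_eq sum_distrib_right)
    also have "(\<Sum>j<M+3. coef j) = (real M + 3) * C\<^sup>2 + 4 * E"
      by (simp add: coef_def plateau_weight_def sum.distrib sum_distrib_left[symmetric] of_bool_def sum.delta)
    finally have "(B\<^sup>2 * real M) * m \<le> ((real M + 3) * C\<^sup>2 + 4 * E) * m" by simp
    then have "B\<^sup>2 * real M \<le> (real M + 3) * C\<^sup>2 + 4 * E" using m by simp
    then show ?thesis by (simp add: algebra_simps)
  qed
  have "B\<^sup>2 \<le> C\<^sup>2"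
  proof (rule ccontr)
    assume "\<not> B\<^sup>2 \<le> C\<^sup>2"
    then have "B\<^sup>2 - C\<^sup>2 > 0" by simp
    then obtain M :: nat where "3 * C\<^sup>2 + 4 * E < real M * (B\<^sup>2 - C\<^sup>2)"
      using reals_Archimedean3 by blast
    then show False using bound[of M] by simp
  qed
  then show ?thesis by (simp add: C_def a_def)
qed

end

theorem theorem3p1:
  fixes mul :: "real^'n::finite \<Rightarrow> real^'n \<Rightarrow> real^'n"
    and w :: "'n \<Rightarrow> nat"
    and X :: "'n \<Rightarrow> real^'n \<Rightarrow> real^'n"
    and N :: nat
    and \<delta> :: real
  assumes "stratified_group mul w X"
    and "N = card (first_stratum w)"
    and "N \<ge> 3"
    and "- real N / 2 \<le> \<delta>" and "\<delta> \<le> -1"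
  shows "(\<forall>f \<in> test_functions {x. horizontal_norm w x \<noteq> 0}.
            L2_norm (\<lambda>x. sub_laplacian w X f x / of_real (horizontal_norm w x powr \<delta>))
              \<ge> \<bar>(real N - 2 * \<delta> - 4) * (real N + 2 * \<delta>) / 4\<bar>
                * L2_norm (\<lambda>x. f x / of_real (horizontal_norm w x powr (\<delta> + 2))))
       \<and> (real N + 2 * \<delta> \<noteq> 0 \<longrightarrow>
           (\<forall>C > \<bar>(real N - 2 * \<delta> - 4) * (real N + 2 * \<delta>) / 4\<bar>.
             \<not> (\<forall>f \<in> test_functions {x. horizontal_norm w x \<noteq> 0}.
                  L2_norm (\<lambda>x. sub_laplacian w X f x / of_real (horizontal_norm w x powr \<delta>))
                    \<ge> C * L2_norm (\<lambda>x. f x / of_real (horizontal_norm w x powr (\<delta> + 2))))))"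
proof -
  interpret stratified_group mul w X by fact
  define c where "c = (real N - 2 * \<delta> - 4) * (real N + 2 * \<delta>) / 4"
  have c: "c \<ge> 0"
    unfolding c_def using assms(3-5) by (intro divide_nonneg_nonneg mult_nonneg_nonneg) auto
  have ineq: "\<bar>c\<bar> * L2_norm (\<lambda>x. f x / of_real (horizontal_norm w x powr (\<delta> + 2)))
      \<le> L2_norm (\<lambda>x. sub_laplacian w X f x / of_real (horizontal_norm w x powr \<delta>))"
    if f: "f \<in> test_functions {x. horizontal_norm w x \<noteq> 0}" for f
  proof -
    have "c\<^sup>2 * (\<integral>x. (norm (f x))\<^sup>2 * horiz_sq w x powr (- (\<delta> + 2)) \<partial>lborel)
        \<le> (\<integral>x. (norm (sub_laplacian w X f x))\<^sup>2 * horiz_sq w x powr (- \<delta>) \<partial>lborel)"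
      by (rule rellich_integral_inequality[OF f _ c]) (simp only: c_def assms(2))
    from real_sqrt_le_mono[OF this] show ?thesis
      unfolding L2_norm_weighted by (simp only: real_sqrt_mult real_sqrt_abs)
  qed
  have sharp: False
    if C: "C > \<bar>c\<bar>" and "\<forall>f \<in> test_functions {x. horizontal_norm w x \<noteq> 0}.
        L2_norm (\<lambda>x. sub_laplacian w X f x / of_real (horizontal_norm w x powr \<delta>))
          \<ge> C * L2_norm (\<lambda>x. f x / of_real (horizontal_norm w x powr (\<delta> + 2)))" for C
  proof -
    have "first_stratum w \<noteq> {}" using assms(2,3) by (metis card.empty not_numeral_le_zero)
    then have "C\<^sup>2 \<le> c\<^sup>2"
      unfolding c_def assms(2) using that assms(5) by (intro rellich_constant_le) auto
    then show False using C abs_le_square_iff[of C c] by simp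
  qed
  show ?thesis
    unfolding c_def[symmetric] using ineq sharp by blast
qed

end
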